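(* Let $G$ be a connected directed graph on the $n+1$ vertices $[n+1]$ with $m$ edges and shifted out-degree vector $\mathbf{t}=(t_1,\ldots,t_n)$, and let $\mathbf{a}$ be a net flow vector of the form $\mathbf{a}=a\mathbf{e}_1+b\mathbf{e}_k\in\mathbb{Z}^n$ for positive integers $a$ and $b$ and $2\le k\le n$. Then the volume of $\mathcal{F}_G(\mathbf{a})$ is the binomial transform of a sequence of Kostant partition functions. More precisely, $$\operatorname{vol}\mathcal{F}_G(a\mathbf{e}_1+b\mathbf{e}_k)=\sum_{i=0}^{m-n-t_1}\binom{m-n}{i}\,a^{m-n-i}\,b^i\;K_{G|_n}(m-n-i-t_1,-t_2,\ldots,-t_{k-1},\,i-t_k,\,-t_{k+1},\ldots,-t_n).$$
   Context: Directed graphs $G$ have vertex set $[n+1]=\{1,\ldots,n+1\}$, may have multiple edges, and every edge $(i,j)$ is directed from smaller vertex $i$ to larger vertex $j$; $m=|E(G)|$. The shifted out-degree vector is $\mathbf{t}=(t_1,\ldots,t_n)$, $t_i=(\text{out-degree of }i)-1$. $G|_n$ is the restriction of $G$ to the vertices $1,\ldots,n$. $\mathbf{e}_i$ are the standard basis vectors. Flow polytope: $\mathcal{F}_G(\mathbf{a})\subset\mathbb{R}^m$ is the set of tuples $(b_e)_{e\in E(G)}$ of nonnegative reals such that for each $j=1,\ldots,n$, (sum of $b_e$ over edges leaving $j$) minus (sum of $b_e$ over edges entering $j$) equals $a_j$. It lies in an affine subspace of dimension $m-n$, and $\operatorname{vol}$ is normalized volume: $(m-n)!$ times the $(m-n)$-dimensional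 volume, normalized so that a fundamental cell of the lattice of integer points of the linear subspace parallel to this affine subspace has volume $1$. Kostant partition function: for $\mathbf{v}\in\mathbb{Z}^n$ with entry sum $0$, $K_{G|_n}(\mathbf{v})$ is the number of nonnegative integer tuples $(b_e)_{e\in E(G|_n)}$ with $\sum_{e=(i,j)}b_e(\mathbf{e}_i-\mathbf{e}_j)=\mathbf{v}$.
   Formalization: It is additionally assumed that each of the vertices 1,…,n has at least one outgoing edge; without this the formula fails, e.g. for n=3, k=2 and edges 1→2, 1→3, 2→4, where the volume is 1 but the sum is empty. *)

theory Defs
  imports "HOL-Analysis.Analysis" "Graph_Theory.Digraph_Component"
begin

locale flow_graph = fin_digraph G for G :: "(nat, 'e) pre_digraph" and n :: nat +
  assumes verts_eq: "verts G = {1..n + 1}"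
    and forward: "e \<in> arcs G \<Longrightarrow> tail G e < head G e"

definition shifted_out_degree :: "(nat, 'e) pre_digraph \<Rightarrow> nat \<Rightarrow> int" where
  "shifted_out_degree G i = int (out_degree G i) - 1"

text \<open>Vectors indexed by the edges, the elements of \<open>\<real>\<^sup>m\<close>, are functions on the edge type that are
  \<open>undefined\<close> outside \<open>arcs G\<close>.\<close>

definition net_flow :: "(nat, 'e) pre_digraph \<Rightarrow> ('e \<Rightarrow> real) \<Rightarrow> nat \<Rightarrow> real" where
  "net_flow G x j = (\<Sum>e\<in>out_arcs G j. x e) - (\<Sum>e\<in>in_arcs G j. x e)"

text \<open>No equation is imposed at the vertex \<open>n + 1\<close>: it follows from the other ones, its net flow
  being minus the sum of the entries of the given vector.\<close>

definition flow_space :: "(nat, 'e) pre_digraph \<Rightarrow> nat \<Rightarrow> (nat \<Rightarrow> real) \<Rightarrow> ('e \<Rightarrow> real) set" where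
  "flow_space G n a = {x \<in> arcs G \<rightarrow>\<^sub>E UNIV. \<forall>j\<in>{1..n}. net_flow G x j = a j}"

definition flow_polytope :: "(nat, 'e) pre_digraph \<Rightarrow> nat \<Rightarrow> (nat \<Rightarrow> real) \<Rightarrow> ('e \<Rightarrow> real) set" where
  "flow_polytope G n a = {x \<in> flow_space G n a. \<forall>e\<in>arcs G. 0 \<le> x e}"

text \<open>\<open>w 0, \<dots>, w (d - 1)\<close> is a \<open>\<int>\<close>-basis of the lattice of integer points of the linear subspace
  \<open>V\<close> of \<open>\<real>\<^sup>E\<close>.\<close>

definition integer_lattice_basis ::
    "'e set \<Rightarrow> ('e \<Rightarrow> real) set \<Rightarrow> nat \<Rightarrow> (nat \<Rightarrow> 'e \<Rightarrow> real) \<Rightarrow> bool" where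
  "integer_lattice_basis E V d w \<longleftrightarrow>
     (\<forall>i<d. w i \<in> V \<inter> (E \<rightarrow>\<^sub>E \<int>)) \<and>
     (\<forall>z \<in> V \<inter> (E \<rightarrow>\<^sub>E \<int>). \<exists>!c. c \<in> {..<d} \<rightarrow>\<^sub>E (UNIV :: int set) \<and>
        (\<forall>e\<in>E. z e = (\<Sum>i<d. of_int (c i) * w i e)))"

text \<open>The \<open>d\<close>-dimensional volume of a subset \<open>P\<close> of the affine subspace \<open>A\<close> of \<open>\<real>\<^sup>E\<close> with parallel
  linear subspace \<open>V\<close>, normalized so that a fundamental cell of the lattice of integer points of
  \<open>V\<close> has volume \<open>1\<close>: the Lebesgue measure of \<open>P\<close> in the coordinates given by an origin \<open>p \<in> A\<close>
  and a lattice basis \<open>w\<close>. Two such charts differ by a translation and a unimodular linear map,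
  so that the choice does not matter.\<close>

definition lattice_volume ::
    "'e set \<Rightarrow> ('e \<Rightarrow> real) set \<Rightarrow> ('e \<Rightarrow> real) set \<Rightarrow> nat \<Rightarrow> ('e \<Rightarrow> real) set \<Rightarrow> real" where
  "lattice_volume E A V d P =
     (let (p, w) = (SOME (p, w). p \<in> A \<and> integer_lattice_basis E V d w)
      in measure (PiM {..<d} (\<lambda>_. lborel))
           {x \<in> {..<d} \<rightarrow>\<^sub>E UNIV. (\<lambda>e\<in>E. p e + (\<Sum>i<d. x i * w i e)) \<in> P})"

definition flow_volume :: "(nat, 'e) pre_digraph \<Rightarrow> nat \<Rightarrow> (nat \<Rightarrow> real) \<Rightarrow> real" where
  "flow_volume G n a =
     fact (card (arcs G) - n) *
     lattice_volume (arcs G) (flow_space G n a) (flow_space G n (\<lambda>_. 0)) (card (arcs G) - n)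
       (flow_polytope G n a)"

definition kostant_partition :: "(nat, 'e) pre_digraph \<Rightarrow> (nat \<Rightarrow> int) \<Rightarrow> nat" where
  "kostant_partition H v =
     card {b \<in> arcs H \<rightarrow>\<^sub>E (UNIV :: nat set). \<forall>j\<in>verts H.
       (\<Sum>e\<in>arcs H. int (b e) * (of_bool (j = tail H e) - of_bool (j = head H e))) = v j}"

end

theory Submission
  imports Defs
begin

text \<open>Fix one exit arc at each of the vertices \<open>1, \<dots>, n\<close>. A flow is determined by its net flow at these
  vertices and its values on the other, free, arcs, and integral data give integral flows. So the
  free arcs provide a lattice chart, and any two lattice charts differ by a unimodular map.

  In this chart the volume is computed for all nonnegative \<open>a\<close> (a Lidskii formula) by removing an arc
  \<open>e\<close> with minimal tail \<open>i\<close> and head \<open>h\<close>. If \<open>e\<close> is free, Fubini's theorem integrates the volume for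
  \<open>a - y e\<^sub>i + y e\<^sub>h\<close> over \<open>0 \<le> y \<le> a i\<close>; if \<open>e\<close> is the only arc that leaves \<open>i\<close>, it carries the whole of \<open>a i\<close>.
  With divided powers \<open>x\<^sup>n / n!\<close> both steps distribute the exponent of \<open>a h\<close> between \<open>a i\<close> and \<open>a h\<close>,
  and the amount moved is the value at \<open>e\<close> of the integral flow counted by the Kostant partition
  function.\<close>

section \<open>Unimodular maps preserve Lebesgue measure\<close>

text \<open>The chart in \<open>lattice_volume\<close> is an unspecified choice, so the volume has
  to be found in every lattice chart at once. The computation runs over all nonnegative real vectors
  because removing an arc moves net flow to its head and destroys the shape of a vector supported on
  two vertices. Minimality of the tail i means that no remaining arc enters i; hence the flow out of
  i is exactly \<open>a i\<close>, which bounds the free variable. The resulting polynomial is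
  homogeneous of degree m - n; the power of \<open>a j\<close> is t_j plus the net flow of the
  integral flow at j. Vertex n + 1 has no variable, so arcs into it move no exponent: this is where
  the restriction of the graph to 1, ..., n comes from. When only \<open>a 1\<close> and
  \<open>a k\<close> are nonzero, every other exponent must vanish. If the exponent at k is r, that
  at 1 is m - n - r, and the net flows so prescribed are the argument of the Kostant partition
  function. The factor (m - n)! turns the two divided powers into a binomial coefficient.\<close>

abbreviation lborel_on :: "'i set \<Rightarrow> ('i \<Rightarrow> real) measure" where
  "lborel_on I \<equiv> PiM I (\<lambda>_. lborel)"

interpretation lborel_on: product_sigma_finite "\<lambda>_. lborel :: real measure"
  by standard

lemma space_lborel_on [simp]: "space (lborel_on I) = I \<rightarrow>\<^sub>E UNIV"
  by (simp add: space_PiM)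

section \<open>Translation invariance of Lebesgue measure on a finite product\<close>

lemma distr_lborel_on_translation:
  assumes I: "finite I"
  shows "distr (lborel_on I) (lborel_on I) (\<lambda>x. \<lambda>i\<in>I. x i + c i) = lborel_on I" (is "?D = _")
proof (rule lborel_on.PiM_eqI)
  fix A :: "_ \<Rightarrow> real set"
  assume A: "\<And>i. i \<in> I \<Longrightarrow> A i \<in> sets lborel"
  have M: "(\<lambda>x. \<lambda>i\<in>I. x i + c i) \<in> lborel_on I \<rightarrow>\<^sub>M lborel_on I"
    by measurable
  have A': "(\<lambda>t. t + c i) -` A i \<in> sets lborel" if "i \<in> I" for i
    using measurable_sets[of "\<lambda>t. t + c i" lborel lborel "A i"] A[OF that] by simp
  have "emeasure ?D (Pi\<^sub>E I A) =
      emeasure (lborel_on I) ((\<lambda>x. \<lambda>i\<in>I. x i + c i) -` Pi\<^sub>E I A \<inter> space (lborel_on I))"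
    using A I by (intro emeasure_distr M sets_PiM_I_finite) auto
  also have "(\<lambda>x. \<lambda>i\<in>I. x i + c i) -` Pi\<^sub>E I A \<inter> space (lborel_on I) =
      Pi\<^sub>E I (\<lambda>i. (\<lambda>t. t + c i) -` A i)"
    by (auto simp: PiE_iff)
  also have "emeasure (lborel_on I) \<dots> = (\<Prod>i\<in>I. emeasure lborel ((\<lambda>t. t + c i) -` A i))"
    using A' I by (intro lborel_on.emeasure_PiM) auto
  also have "\<dots> = (\<Prod>i\<in>I. emeasure lborel (A i))"
  proof (intro prod.cong refl)
    fix i assume i: "i \<in> I"
    have "emeasure lborel (A i) = emeasure (distr lborel borel ((+) (c i))) (A i)"
      by (simp add: lborel_distr_plus)
    also have "\<dots> = emeasure lborel ((+) (c i) -` A i)"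
      using A[OF i] by (subst emeasure_distr) auto
    finally show "emeasure lborel ((\<lambda>t. t + c i) -` A i) = emeasure lborel (A i)"
      by (simp add: add.commute[of _ "c i"])
  qed
  finally show "emeasure ?D (Pi\<^sub>E I A) = (\<Prod>i\<in>I. emeasure lborel (A i))" .
qed (use I in simp_all)

lemma nn_integral_lborel_on_translation:
  assumes "finite I" and f: "f \<in> borel_measurable (lborel_on I)"
  shows "(\<integral>\<^sup>+x. f (\<lambda>i\<in>I. x i + c i) \<partial>lborel_on I) = (\<integral>\<^sup>+x. f x \<partial>lborel_on I)"
proof -
  have "(\<integral>\<^sup>+x. f x \<partial>lborel_on I) = (\<integral>\<^sup>+x. f x \<partial>distr (lborel_on I) (lborel_on I) (\<lambda>x. \<lambda>i\<in>I. x i + c i))"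
    by (simp add: distr_lborel_on_translation assms)
  also have "\<dots> = (\<integral>\<^sup>+x. f (\<lambda>i\<in>I. x i + c i) \<partial>lborel_on I)"
  proof (rule nn_integral_distr)
    show "(\<lambda>x. \<lambda>i\<in>I. x i + c i) \<in> lborel_on I \<rightarrow>\<^sub>M lborel_on I"
      by measurable
  qed (use f in simp)
  finally show ?thesis ..
qed

lemma emeasure_lborel_on_translation:
  assumes I: "finite I" and A: "A \<in> sets (lborel_on I)"
  shows "emeasure (lborel_on I) {x \<in> I \<rightarrow>\<^sub>E UNIV. (\<lambda>i\<in>I. x i + c i) \<in> A} = emeasure (lborel_on I) A"
proof -
  have "emeasure (lborel_on I) A = emeasure (distr (lborel_on I) (lborel_on I) (\<lambda>x. \<lambda>i\<in>I. x i + c i)) A"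
    by (simp add: distr_lborel_on_translation I)
  also have "\<dots> = emeasure (lborel_on I) ((\<lambda>x. \<lambda>i\<in>I. x i + c i) -` A \<inter> space (lborel_on I))"
    by (intro emeasure_distr A) measurable
  also have "(\<lambda>x. \<lambda>i\<in>I. x i + c i) -` A \<inter> space (lborel_on I) =
      {x \<in> I \<rightarrow>\<^sub>E UNIV. (\<lambda>i\<in>I. x i + c i) \<in> A}"
    by (auto simp del: restrict_apply)
  finally show ?thesis ..
qed

text \<open>Invertibility over the integers is encoded by mutually inverse matrices:
  \<open>I\<close> and \<open>J\<close> have different types, so a determinant would first need an
  identification of the two. The two identities make \<open>T\<close> and \<open>S\<close> inverse
  to each other, and both preserve integer points.\<close>

locale unimodular =
  fixes I :: "'i set" and J :: "'j set" and w :: "'i \<Rightarrow> 'j \<Rightarrow> int" and u :: "'j \<Rightarrow> 'i \<Rightarrow> int"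
  assumes finite_I [simp]: "finite I" and finite_J [simp]: "finite J"
    and wu: "\<And>i i'. i \<in> I \<Longrightarrow> i' \<in> I \<Longrightarrow> (\<Sum>j\<in>J. w i j * u j i') = of_bool (i = i')"
    and uw: "\<And>j j'. j \<in> J \<Longrightarrow> j' \<in> J \<Longrightarrow> (\<Sum>i\<in>I. u j i * w i j') = of_bool (j = j')"
begin

definition T :: "('i \<Rightarrow> real) \<Rightarrow> 'j \<Rightarrow> real" where
  "T x = (\<lambda>j\<in>J. \<Sum>i\<in>I. x i * of_int (w i j))"

definition S :: "('j \<Rightarrow> real) \<Rightarrow> 'i \<Rightarrow> real" where
  "S y = (\<lambda>i\<in>I. \<Sum>j\<in>J. y j * of_int (u j i))"

lemma T_S: "T (S y) = restrict y J"
proof -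
  have "(\<Sum>i\<in>I. (\<Sum>j\<in>J. y j * of_int (u j i)) * of_int (w i j')) = y j'" if j': "j' \<in> J" for j'
  proof -
    have "(\<Sum>i\<in>I. (\<Sum>j\<in>J. y j * of_int (u j i)) * of_int (w i j')) =
        (\<Sum>i\<in>I. \<Sum>j\<in>J. y j * of_int (u j i * w i j'))"
      by (simp add: sum_distrib_right mult.assoc)
    also have "\<dots> = (\<Sum>j\<in>J. \<Sum>i\<in>I. y j * of_int (u j i * w i j'))"
      by (rule sum.swap)
    also have "\<dots> = (\<Sum>j\<in>J. y j * of_int (\<Sum>i\<in>I. u j i * w i j'))"
      by (simp add: sum_distrib_left)
    also have "\<dots> = (\<Sum>j\<in>J. if j = j' then y j else 0)"
      using j' by (intro sum.cong refl) (auto simp: uw)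
    finally show ?thesis
      using j' by simp
  qed
  then show ?thesis
    by (auto simp: T_def S_def)
qed

lemma S_T: "S (T x) = restrict x I"
proof -
  have "(\<Sum>j\<in>J. (\<Sum>i\<in>I. x i * of_int (w i j)) * of_int (u j i')) = x i'" if i': "i' \<in> I" for i'
  proof -
    have "(\<Sum>j\<in>J. (\<Sum>i\<in>I. x i * of_int (w i j)) * of_int (u j i')) =
        (\<Sum>j\<in>J. \<Sum>i\<in>I. x i * of_int (w i j * u j i'))"
      by (simp add: sum_distrib_right mult.assoc)
    also have "\<dots> = (\<Sum>i\<in>I. \<Sum>j\<in>J. x i * of_int (w i j * u j i'))"
      by (rule sum.swap)
    also have "\<dots> = (\<Sum>i\<in>I. x i * of_int (\<Sum>j\<in>J. w i j * u j i'))"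
      by (simp add: sum_distrib_left)
    also have "\<dots> = (\<Sum>i\<in>I. if i = i' then x i else 0)"
      using i' by (intro sum.cong refl) (auto simp: wu)
    finally show ?thesis
      using i' by simp
  qed
  then show ?thesis
    by (auto simp: T_def S_def)
qed

lemma T_add: "T (\<lambda>i\<in>I. x i + x' i) = (\<lambda>j\<in>J. T x j + T x' j)"
  by (auto simp: T_def sum.distrib algebra_simps)

lemma T_in [simp]: "T x \<in> J \<rightarrow>\<^sub>E UNIV"
  by (simp add: T_def)

lemma T_int: "x \<in> I \<rightarrow>\<^sub>E \<int> \<Longrightarrow> T x \<in> J \<rightarrow>\<^sub>E \<int>"
  by (auto simp: T_def PiE_iff intro!: Ints_sum Ints_mult)

lemma S_int: "y \<in> J \<rightarrow>\<^sub>E \<int> \<Longrightarrow> S y \<in> I \<rightarrow>\<^sub>E \<int>"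
  by (auto simp: S_def PiE_iff intro!: Ints_sum Ints_mult)

lemma T_measurable [measurable]: "T \<in> lborel_on I \<rightarrow>\<^sub>M lborel_on J"
  unfolding T_def by measurable

lemma T_component_measurable [measurable]:
  assumes [measurable]: "f \<in> N \<rightarrow>\<^sub>M lborel_on I"
  shows "(\<lambda>x. T (f x) j) \<in> borel_measurable N"
proof (cases "j \<in> J")
  case True
  have "(\<lambda>x. f x i) \<in> borel_measurable N" if "i \<in> I" for i
    using measurable_compose[OF assms measurable_component_singleton[OF that]] by simp
  with True show ?thesis
    by (auto simp: T_def)
qed (simp add: T_def)

lemma T_zero_one_sets [measurable]:
  "{x \<in> I \<rightarrow>\<^sub>E UNIV. T x \<in> J \<rightarrow>\<^sub>E {0..<1}} \<in> sets (lborel_on I)"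
proof -
  have "(J \<rightarrow>\<^sub>E {0..<1::real}) \<in> sets (lborel_on J)"
    by (intro sets_PiM_I_finite) auto
  from measurable_sets[OF T_measurable this] show ?thesis
    by (simp add: Int_def vimage_def conj_commute)
qed

text \<open>The set and the unit cube are both fundamental domains of the lattice of integer points.\<close>

lemma emeasure_T_zero_one:
  "emeasure (lborel_on I) {x \<in> I \<rightarrow>\<^sub>E UNIV. T x \<in> J \<rightarrow>\<^sub>E {0..<1}} = 1"
proof -
  define Z where "Z = I \<rightarrow>\<^sub>E (\<int> :: real set)"
  define D where "D = {x \<in> I \<rightarrow>\<^sub>E UNIV. T x \<in> J \<rightarrow>\<^sub>E {0..<1}}"
  define Q where "Q = (I \<rightarrow>\<^sub>E {0..<1::real})"
  let ?M = "lborel_on I"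
  define sh where "sh z x = (\<lambda>i\<in>I. x i + z i)" for z x :: "'i \<Rightarrow> real"
  define ng where "ng z = (\<lambda>i\<in>I. - z i)" for z :: "'i \<Rightarrow> real"
  have sh_meas [measurable]: "sh z \<in> ?M \<rightarrow>\<^sub>M ?M" for z
    unfolding sh_def by measurable
  have [measurable]: "D \<in> sets ?M"
    unfolding D_def by measurable
  have [measurable]: "Q \<in> sets ?M"
    unfolding Q_def by (intro sets_PiM_I_finite) auto
  have cZ: "countable Z"
    unfolding Z_def by (intro countable_PiE countable_int) auto
  have bij: "bij_betw ng Z Z"
    by (rule bij_betwI[where g = ng]) (auto simp: ng_def Z_def PiE_iff restrict_def fun_eq_iff extensional_def)
  define tr where "tr A z = {x \<in> I \<rightarrow>\<^sub>E UNIV. sh z x \<in> A}" for A z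
  have tr_sets [measurable]: "tr A z \<in> sets ?M" if "A \<in> sets ?M" for A z
    using measurable_sets[OF sh_meas[of z] that] by (simp add: tr_def Int_def vimage_def conj_commute)
  have shI: "sh z x \<in> I \<rightarrow>\<^sub>E UNIV" for z x
    by (simp add: sh_def)
  have Tsh: "T (sh z x) = (\<lambda>j\<in>J. T x j + T z j)" for z x
    unfolding sh_def by (rule T_add)
  have uniqD: "\<exists>!z. z \<in> Z \<and> x \<in> tr D z" if x: "x \<in> I \<rightarrow>\<^sub>E UNIV" for x
  proof
    \<comment> \<open>\<open>T x + fl\<close> lies in the half-open cube, so \<open>S fl\<close> is
      the integer vector that moves \<open>x\<close> into \<open>D\<close>.\<close>
    define fl where "fl = (\<lambda>j\<in>J. - real_of_int \<lfloor>T x j\<rfloor>)"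
    have fl: "fl \<in> J \<rightarrow>\<^sub>E \<int>"
      by (auto simp: fl_def)
    have TSfl: "T (S fl) = fl"
      by (simp add: T_S fl_def)
    have "T (sh (S fl) x) \<in> J \<rightarrow>\<^sub>E {0..<1}"
      unfolding Tsh TSfl by (auto simp: fl_def) linarith+
    then show "S fl \<in> Z \<and> x \<in> tr D (S fl)"
      using fl x by (simp add: Z_def S_int tr_def D_def shI)
    fix z assume z: "z \<in> Z \<and> x \<in> tr D z"
    have Tz: "T z j \<in> \<int>" if "j \<in> J" for j
      using z T_int[of z] that by (auto simp: Z_def PiE_iff)
    have "T z j = fl j" for j
    proof (cases "j \<in> J")
      case True
      have "T x j + T z j \<in> {0..<1}"
        using z True by (auto simp: tr_def D_def Tsh PiE_iff)
      moreover obtain k where k: "T z j = of_int k"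
        using Tz[OF True] by (auto elim: Ints_cases)
      ultimately have "\<lfloor>T x j\<rfloor> = - k"
        by (intro floor_unique) auto
      then show ?thesis
        using True k by (simp add: fl_def)
    next
      case False
      then show ?thesis
        by (simp add: fl_def T_def)
    qed
    then have "T z = fl" ..
    then have "S (T z) = S fl"
      by simp
    then show "z = S fl"
      using z by (simp add: S_T Z_def PiE_def extensional_restrict)
  qed
  have uniqQ: "\<exists>!z. z \<in> Z \<and> x \<in> tr Q z" if x: "x \<in> I \<rightarrow>\<^sub>E UNIV" for x
  proof
    define fl where "fl = (\<lambda>i\<in>I. - real_of_int \<lfloor>x i\<rfloor>)"
    have "x i + fl i \<in> {0..<1}" if "i \<in> I" for i
      unfolding fl_def using that by simp linarith
    then show "fl \<in> Z \<and> x \<in> tr Q fl"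
      using x by (auto simp: Z_def fl_def tr_def Q_def sh_def)
    fix z assume z: "z \<in> Z \<and> x \<in> tr Q z"
    have "z i = fl i" for i
    proof (cases "i \<in> I")
      case True
      have "x i + z i \<in> {0..<1}"
        using z True by (auto simp: tr_def Q_def sh_def PiE_iff)
      moreover obtain k where k: "z i = of_int k"
        using z True by (auto simp: Z_def PiE_iff elim: Ints_cases)
      ultimately have "\<lfloor>x i\<rfloor> = - k"
        by (intro floor_unique) auto
      then show ?thesis
        using True k by (simp add: fl_def)
    next
      case False
      then show ?thesis
        using z by (simp add: fl_def Z_def PiE_iff extensional_def)
    qed
    then show "z = fl" ..
  qed
  \<comment> \<open>For a fundamental domain \<open>A\<close>, exactly one \<open>z\<close> moves a
    given point into \<open>A\<close>; so the sets \<open>tr A z\<close> partition the space and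
    countable additivity applies.\<close>
  have dec: "emeasure ?M B = (\<integral>\<^sup>+z. emeasure ?M (B \<inter> tr A z) \<partial>count_space Z)"
    if [measurable]: "A \<in> sets ?M" "B \<in> sets ?M"
      and un: "\<And>x. x \<in> I \<rightarrow>\<^sub>E UNIV \<Longrightarrow> \<exists>!z. z \<in> Z \<and> x \<in> tr A z" for A B
  proof -
    have B: "B \<subseteq> I \<rightarrow>\<^sub>E UNIV"
      using sets.sets_into_space[OF that(2)] by simp
    have "B = (\<Union>z\<in>Z. B \<inter> tr A z)"
    proof (intro set_eqI iffI)
      fix x assume x: "x \<in> B"
      with B un[of x] obtain z where "z \<in> Z" "x \<in> tr A z"
        by blast
      with x show "x \<in> (\<Union>z\<in>Z. B \<inter> tr A z)"
        by blast
    qed blast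
    then have "emeasure ?M B = emeasure ?M (\<Union>z\<in>Z. B \<inter> tr A z)"
      by simp
    also have "\<dots> = (\<integral>\<^sup>+z. emeasure ?M (B \<inter> tr A z) \<partial>count_space Z)"
    proof (intro emeasure_UN_countable cZ)
      have "z = z'" if "z \<in> Z" "z' \<in> Z" "x \<in> B" "x \<in> tr A z" "x \<in> tr A z'" for x z z'
        using B un[of x] that by blast
      then show "disjoint_family_on (\<lambda>z. B \<inter> tr A z) Z"
        unfolding disjoint_family_on_def by blast
    qed simp
    finally show ?thesis .
  qed
  \<comment> \<open>Translation by \<open>z\<close> carries the piece of \<open>D\<close> that lands
    in \<open>Q\<close> onto the piece of \<open>Q\<close> that comes from \<open>D\<close>; the two
    measures are compared piece by piece.\<close>
  have swap: "emeasure ?M (D \<inter> tr Q z) = emeasure ?M (Q \<inter> tr D (ng z))" if z: "z \<in> Z" for z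
  proof -
    have *: "sh (ng z) (sh z x) = x" if "x \<in> I \<rightarrow>\<^sub>E UNIV" for x
      using that by (auto simp: sh_def ng_def PiE_iff extensional_def restrict_def)
    have "emeasure ?M (Q \<inter> tr D (ng z)) = emeasure ?M {x \<in> I \<rightarrow>\<^sub>E UNIV. (\<lambda>i\<in>I. x i + z i) \<in> Q \<inter> tr D (ng z)}"
      by (intro emeasure_lborel_on_translation[symmetric]) auto
    also have "{x \<in> I \<rightarrow>\<^sub>E UNIV. (\<lambda>i\<in>I. x i + z i) \<in> Q \<inter> tr D (ng z)} = D \<inter> tr Q z"
      unfolding sh_def[symmetric] using shI * by (auto simp: tr_def)
    finally show ?thesis ..
  qed
  have "emeasure ?M D = (\<integral>\<^sup>+z. emeasure ?M (D \<inter> tr Q z) \<partial>count_space Z)"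
    by (intro dec uniqQ) auto
  also have "\<dots> = (\<integral>\<^sup>+z. emeasure ?M (Q \<inter> tr D (ng z)) \<partial>count_space Z)"
    by (intro nn_integral_cong swap) simp
  also have "\<dots> = (\<integral>\<^sup>+z. emeasure ?M (Q \<inter> tr D z) \<partial>count_space Z)"
    by (rule nn_integral_bij_count_space[OF bij])
  also have "\<dots> = emeasure ?M Q"
    by (intro dec[symmetric] uniqD) auto
  also have "\<dots> = 1"
    unfolding Q_def by (subst lborel_on.emeasure_PiM) auto
  finally show ?thesis
    by (simp add: D_def)
qed

text \<open>The usual proof of the uniqueness of Haar measure: integrate
  \<open>indicator A (T x) * indicator (J \<rightarrow>\<^sub>E {-1<..0}) (y - T x)\<close> in both orders.\<close>

lemma emeasure_preimage:
  assumes A [measurable]: "A \<in> sets (lborel_on J)"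
  shows "emeasure (lborel_on I) {x \<in> I \<rightarrow>\<^sub>E UNIV. T x \<in> A} = emeasure (lborel_on J) A"
proof -
  let ?M = "lborel_on I" and ?N = "lborel_on J"
  interpret sI: sigma_finite_measure ?M by (rule lborel_on.sigma_finite) simp
  interpret sJ: sigma_finite_measure ?N by (rule lborel_on.sigma_finite) simp
  interpret P: pair_sigma_finite ?M ?N ..
  \<comment> \<open>This cube is closed at its upper end because its argument becomes
    \<open>- T x\<close> below: \<open>- T x\<close> lies in it iff \<open>T x\<close> lies in the
    cube with sides \<open>{0..<1}\<close>.\<close>
  define B where "B = (J \<rightarrow>\<^sub>E {-1<..0::real})"
  have [measurable]: "B \<in> sets ?N"
    unfolding B_def by (intro sets_PiM_I_finite) auto
  have "emeasure ?N B = 1"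
    unfolding B_def by (subst lborel_on.emeasure_PiM) auto
  define sub where "sub x y = (\<lambda>j\<in>J. y j + - T x j)" for x y
  have sub_meas [measurable]: "case_prod sub \<in> ?M \<Otimes>\<^sub>M ?N \<rightarrow>\<^sub>M ?N"
    unfolding sub_def split_def by measurable
  have add_meas [measurable]: "(\<lambda>(x, y). \<lambda>j\<in>J. y j + T x j) \<in> ?M \<Otimes>\<^sub>M ?N \<rightarrow>\<^sub>M ?N"
    unfolding split_def by measurable
  have pre: "{x \<in> I \<rightarrow>\<^sub>E UNIV. T x \<in> A} \<in> sets ?M"
    using measurable_sets[OF T_measurable A] by (simp add: Int_def vimage_def conj_commute)
  have "emeasure ?M {x \<in> I \<rightarrow>\<^sub>E UNIV. T x \<in> A} = (\<integral>\<^sup>+x. indicator {x \<in> I \<rightarrow>\<^sub>E UNIV. T x \<in> A} x \<partial>?M)"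
    using pre by simp
  also have "\<dots> = (\<integral>\<^sup>+x. indicator A (T x) * emeasure ?N B \<partial>?M)"
    by (intro nn_integral_cong) (auto simp: indicator_def \<open>emeasure ?N B = 1\<close>)
  also have "\<dots> = (\<integral>\<^sup>+x. indicator A (T x) * (\<integral>\<^sup>+y. indicator B (sub x y) \<partial>?N) \<partial>?M)"
    unfolding sub_def by (subst nn_integral_lborel_on_translation) auto
  also have "\<dots> = (\<integral>\<^sup>+x. (\<integral>\<^sup>+y. indicator A (T x) * indicator B (sub x y) \<partial>?N) \<partial>?M)"
    by (intro nn_integral_cong nn_integral_cmult[symmetric]) measurable
  also have "\<dots> = (\<integral>\<^sup>+y. (\<integral>\<^sup>+x. indicator A (T x) * indicator B (sub x y) \<partial>?M) \<partial>?N)"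
    by (intro P.Fubini'[symmetric]) measurable
  also have "\<dots> = (\<integral>\<^sup>+y. (\<integral>\<^sup>+x. indicator A (\<lambda>j\<in>J. y j + T x j) * indicator B (\<lambda>j\<in>J. - T x j) \<partial>?M) \<partial>?N)"
  proof (rule nn_integral_cong)
    \<comment> \<open>Shifting \<open>x\<close> by \<open>S y\<close> turns \<open>T x\<close> into
      \<open>y + T x\<close> and \<open>y - T x\<close> into \<open>- T x\<close>. Only the factor
      with \<open>A\<close> then depends on \<open>y\<close>, and its integral over \<open>y\<close>
      is the measure of \<open>A\<close>.\<close>
    fix y assume y: "y \<in> space ?N"
    have "(\<integral>\<^sup>+x. indicator A (T x) * indicator B (sub x y) \<partial>?M) =
       (\<integral>\<^sup>+x. indicator A (T (\<lambda>i\<in>I. x i + S y i)) * indicator B (sub (\<lambda>i\<in>I. x i + S y i) y) \<partial>?M :: ennreal)"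
      using y by (intro nn_integral_lborel_on_translation[symmetric]) measurable
    also have "\<dots> = (\<integral>\<^sup>+x. indicator A (\<lambda>j\<in>J. y j + T x j) * indicator B (\<lambda>j\<in>J. - T x j) \<partial>?M)"
      by (simp add: sub_def T_add T_S algebra_simps cong: restrict_cong)
    finally show "(\<integral>\<^sup>+x. indicator A (T x) * indicator B (sub x y) \<partial>?M) =
       (\<integral>\<^sup>+x. indicator A (\<lambda>j\<in>J. y j + T x j) * indicator B (\<lambda>j\<in>J. - T x j) \<partial>?M :: ennreal)" .
  qed
  also have "\<dots> = (\<integral>\<^sup>+x. (\<integral>\<^sup>+y. indicator A (\<lambda>j\<in>J. y j + T x j) * indicator B (\<lambda>j\<in>J. - T x j) \<partial>?N) \<partial>?M)"
    by (intro P.Fubini') measurable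
  also have "\<dots> = (\<integral>\<^sup>+x. (\<integral>\<^sup>+y. indicator A (\<lambda>j\<in>J. y j + T x j) \<partial>?N) * indicator B (\<lambda>j\<in>J. - T x j) \<partial>?M)"
    by (intro nn_integral_cong nn_integral_multc) measurable
  also have "\<dots> = (\<integral>\<^sup>+x. emeasure ?N A * indicator {x \<in> I \<rightarrow>\<^sub>E UNIV. T x \<in> J \<rightarrow>\<^sub>E {0..<1}} x \<partial>?M)"
  proof (rule nn_integral_cong)
    fix x assume x: "x \<in> space ?M"
    have "(\<lambda>j\<in>J. - T x j) \<in> B \<longleftrightarrow> T x \<in> J \<rightarrow>\<^sub>E {0..<1}"
      using T_in[of x] by (auto simp: B_def PiE_iff)
    then have "(indicator B (\<lambda>j\<in>J. - T x j) :: ennreal) = indicator {x \<in> I \<rightarrow>\<^sub>E UNIV. T x \<in> J \<rightarrow>\<^sub>E {0..<1}} x"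
      using x by (auto simp: indicator_def)
    then show "(\<integral>\<^sup>+y. indicator A (\<lambda>j\<in>J. y j + T x j) \<partial>?N) * indicator B (\<lambda>j\<in>J. - T x j) =
        emeasure ?N A * indicator {x \<in> I \<rightarrow>\<^sub>E UNIV. T x \<in> J \<rightarrow>\<^sub>E {0..<1}} x"
      by (simp add: nn_integral_lborel_on_translation[of J "indicator A"])
  qed
  also have "\<dots> = emeasure ?N A"
    by (simp add: nn_integral_cmult_indicator emeasure_T_zero_one)
  finally show ?thesis .
qed

end

section \<open>Divided powers\<close>

definition dpow :: "real \<Rightarrow> nat \<Rightarrow> real" where
  "dpow x n = x ^ n / fact n"

lemma dpow_0 [simp]: "dpow x 0 = 1"
  by (simp add: dpow_def)

lemma dpow_zero: "dpow 0 n = of_bool (n = 0)"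
  by (simp add: dpow_def)

lemma dpow_nonneg: "0 \<le> x \<Longrightarrow> 0 \<le> dpow x n"
  by (simp add: dpow_def)

lemma dpow_add: "dpow (x + y) q = (\<Sum>v\<le>q. dpow x v * dpow y (q - v))"
proof -
  have "dpow (x + y) q = (\<Sum>v\<le>q. of_nat (q choose v) * x ^ v * y ^ (q - v) / fact q)"
    by (simp add: dpow_def binomial_ring sum_divide_distrib)
  also have "\<dots> = (\<Sum>v\<le>q. dpow x v * dpow y (q - v))"
    by (intro sum.cong refl) (simp add: dpow_def binomial_fact)
  finally show ?thesis .
qed

lemma DERIV_dpow [derivative_intros]:
  assumes "DERIV g x :> g'"
  shows "DERIV (\<lambda>x. dpow (g x) (Suc n)) x :> g' * dpow (g x) n"
proof -
  have "DERIV (\<lambda>x. g x ^ Suc n / fact (Suc n)) x :> (real (Suc n) * (g' * g x ^ n)) / fact (Suc n)"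
    using DERIV_cdivide[OF DERIV_power[OF assms, of "Suc n"], of "fact (Suc n)"] by simp
  also have "(real (Suc n) * (g' * g x ^ n)) / fact (Suc n) = g' * dpow (g x) n"
    by (simp add: dpow_def fact_Suc del: of_nat_Suc)
  finally show ?thesis
    by (simp add: dpow_def)
qed

text \<open>Repeated integration by parts: the term \<open>v = 0\<close> yields the required product
  and an error, which the remaining terms, the case of \<open>Suc p\<close>, cancel. Each summand
  has a positive power of \<open>c - u\<close>, so this antiderivative vanishes at
  \<open>u = c\<close>.\<close>

lemma DERIV_dpow_convolution:
  "DERIV (\<lambda>u. - (\<Sum>v\<le>q. dpow (c - u) (Suc (p + v)) * dpow (h + u) (q - v))) u
     :> dpow (c - u) p * dpow (h + u) q"
proof (induction q arbitrary: p)
  case 0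
  show ?case
    by (auto intro!: derivative_eq_intros)
next
  case (Suc q)
  have "DERIV (\<lambda>u. - (dpow (c - u) (Suc p) * dpow (h + u) (Suc q)) +
      - (\<Sum>v\<le>q. dpow (c - u) (Suc (Suc p + v)) * dpow (h + u) (q - v))) u
     :> - (- 1 * dpow (c - u) p * dpow (h + u) (Suc q) + 1 * dpow (h + u) q * dpow (c - u) (Suc p)) +
        dpow (c - u) (Suc p) * dpow (h + u) q"
    by (intro DERIV_add DERIV_minus DERIV_mult DERIV_dpow Suc.IH) (auto intro!: derivative_eq_intros)
  then show ?case
    by (simp add: sum.atMost_Suc_shift algebra_simps del: sum.atMost_Suc)
qed

section \<open>Flows determined by their values off one exit arc per vertex\<close>

locale exit_choice =
  fixes src dst :: "'e \<Rightarrow> nat" and f :: "nat \<Rightarrow> 'e"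
begin

text \<open>Formulated for arc sets, since the inductions remove arcs. The map \<open>f\<close>
  stays fixed: a set that keeps any arc at a vertex must keep the exit arc there.\<close>

definition exits :: "'e set \<Rightarrow> bool" where
  "exits S \<longleftrightarrow> finite S \<and> (\<forall>e\<in>S. src e < dst e) \<and> (\<forall>i\<in>src ` S. f i \<in> S \<and> src (f i) = i)"

text \<open>The exit arcs, one at each tail and all pointing upwards, form a forest directed to the
  sinks; the free arcs are its chords.\<close>

definition free :: "'e set \<Rightarrow> 'e set" where
  "free S = S - f ` src ` S"

text \<open>The ring is left open because real flows, integral circulations and the flows counted by
  the Kostant partition function all use this expression.\<close>

definition net :: "'e set \<Rightarrow> ('e \<Rightarrow> 'a::comm_ring_1) \<Rightarrow> nat \<Rightarrow> 'a" where
  "net S x i = (\<Sum>e\<in>S. x e * (of_bool (i = src e) - of_bool (i = dst e)))"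

lemma exits_finite [simp]: "exits S \<Longrightarrow> finite S"
  by (simp add: exits_def)

lemma free_subset: "free S \<subseteq> S"
  by (auto simp: free_def)

lemma finite_free [simp]: "exits S \<Longrightarrow> finite (free S)"
  using finite_subset[OF free_subset] by simp

lemma net_insert:
  "finite S \<Longrightarrow> e \<notin> S \<Longrightarrow>
    net (insert e S) x i = net S x i + x e * (of_bool (i = src e) - of_bool (i = dst e))"
  by (simp add: net_def add.commute)

lemma net_cong: "(\<And>e. e \<in> S \<Longrightarrow> x e = y e) \<Longrightarrow> net S x i = net S y i"
  by (simp add: net_def)

lemma net_add: "net S (\<lambda>e. x e + y e) i = net S x i + net S y i"
  by (simp add: net_def sum.distrib distrib_right)

lemma net_lincomb: "net S (\<lambda>e. \<Sum>k\<in>K. c k * w k e) i = (\<Sum>k\<in>K. c k * net S (w k) i)"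
proof -
  have "net S (\<lambda>e. \<Sum>k\<in>K. c k * w k e) i =
      (\<Sum>e\<in>S. \<Sum>k\<in>K. c k * (w k e * (of_bool (i = src e) - of_bool (i = dst e))))"
    by (simp add: net_def sum_distrib_right mult.assoc)
  also have "\<dots> = (\<Sum>k\<in>K. \<Sum>e\<in>S. c k * (w k e * (of_bool (i = src e) - of_bool (i = dst e))))"
    by (rule sum.swap)
  finally show ?thesis
    by (simp add: net_def sum_distrib_left)
qed

lemma net_of_int: "net S (\<lambda>e. of_int (x e)) i = of_int (net S x i)"
  by (simp add: net_def)

lemma net_isolated:
  assumes "\<And>e. e \<in> S \<Longrightarrow> src e \<noteq> i \<and> dst e \<noteq> i"
  shows "net S x i = 0"
  unfolding net_def using assms by (intro sum.neutral) (metis (full_types) diff_zero mult_zero_right of_bool_eq(1))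

lemma net_nonneg:
  fixes x :: "'e \<Rightarrow> 'a::linordered_idom"
  assumes "\<And>e. e \<in> S \<Longrightarrow> 0 \<le> x e" "\<And>e. e \<in> S \<Longrightarrow> dst e \<noteq> i"
  shows "0 \<le> net S x i"
proof -
  have "x e * (of_bool (i = src e) - of_bool (i = dst e)) = x e * of_bool (i = src e)" if "e \<in> S" for e
    using assms(2)[OF that] by auto
  then have "net S x i = (\<Sum>e\<in>S. x e * of_bool (i = src e))"
    unfolding net_def by (rule sum.cong[OF refl])
  then show ?thesis
    using assms(1) by (auto intro!: sum_nonneg)
qed

text \<open>At the smallest tail all other arcs are taken off before the exit arc. Since arcs point
  upwards, none enters that vertex, and once its exit arc is gone no arc touches it.\<close>

lemma exits_induct [consumes 1, case_names empty free exit]: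
  assumes "exits S" and empty: "P {}"
    and free: "\<And>S e. exits S \<Longrightarrow> exits (insert e S) \<Longrightarrow> e \<notin> S \<Longrightarrow> src e \<in> src ` S \<Longrightarrow>
      e \<noteq> f (src e) \<Longrightarrow> (\<And>e'. e' \<in> S \<Longrightarrow> src e \<le> src e') \<Longrightarrow> P S \<Longrightarrow> P (insert e S)"
    and exit: "\<And>S e. exits S \<Longrightarrow> exits (insert e S) \<Longrightarrow> e \<notin> S \<Longrightarrow>
      e = f (src e) \<Longrightarrow> (\<And>e'. e' \<in> S \<Longrightarrow> src e < src e') \<Longrightarrow> P S \<Longrightarrow> P (insert e S)"
  shows "P S"
  using assms(1)
proof (induction "card S" arbitrary: S rule: less_induct)
  case (less S)
  note ex = \<open>exits S\<close>
  show ?case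
  proof (cases "S = {}")
    case True
    then show ?thesis using empty by simp
  next
    case False
    define i where "i = Min (src ` S)"
    have i: "i \<in> src ` S" "\<And>e. e \<in> S \<Longrightarrow> i \<le> src e"
      using ex False by (auto simp: i_def)
    show ?thesis
    proof (cases "\<exists>e\<in>S. src e = i \<and> e \<noteq> f i")
      case True
      then obtain e where e: "e \<in> S" "src e = i" "e \<noteq> f i" by blast
      define S' where "S' = S - {e}"
      have S: "S = insert e S'" "e \<notin> S'"
        using e by (auto simp: S'_def)
      have ex': "exits S'"
        using ex e by (auto simp: exits_def S'_def)
      have "f i \<in> S'" "src (f i) = i"
        using ex e i by (auto simp: exits_def S'_def)
      then have "src e \<in> src ` S'"
        using e by (metis image_eqI)
      moreover have "P S'"
        using card_Diff1_less[OF exits_finite[OF ex] e(1)] by (intro less.hyps ex') (simp add: S'_def)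
      ultimately show ?thesis
        unfolding S(1) using ex ex' S e i by (intro free) auto
    next
      case False
      define e where "e = f i"
      have e: "e \<in> S" "src e = i"
        using ex i by (auto simp: exits_def e_def)
      define S' where "S' = S - {e}"
      have S: "S = insert e S'" "e \<notin> S'"
        using e by (auto simp: S'_def)
      have lt: "i < src e'" if "e' \<in> S'" for e'
        using that False i(2)[of e'] by (force simp: S'_def e_def)
      have ex': "exits S'"
        unfolding exits_def
      proof (intro conjI ballI)
        fix j assume "j \<in> src ` S'"
        then have "j \<in> src ` S" "i < j"
          using lt by (auto simp: S'_def)
        then have "f j \<in> S" "src (f j) = j"
          using ex by (auto simp: exits_def)
        moreover have "f j \<noteq> e"
          using \<open>src (f j) = j\<close> \<open>i < j\<close> e(2) by auto
        ultimately show "f j \<in> S'" "src (f j) = j"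
          by (auto simp: S'_def)
      qed (use ex in \<open>auto simp: exits_def S'_def\<close>)
      have "P S'"
        using card_Diff1_less[OF exits_finite[OF ex] e(1)] by (intro less.hyps ex') (simp add: S'_def)
      then show ?thesis
        unfolding S(1) using ex ex' S e lt by (intro exit) (auto simp: e_def)
    qed
  qed
qed

lemma free_insert_free:
  assumes "exits S" "e \<notin> S" "src e \<in> src ` S" "e \<noteq> f (src e)"
  shows "free (insert e S) = insert e (free S)"
proof -
  have "src ` insert e S = src ` S"
    using assms(3) by auto
  moreover have "e \<notin> f ` src ` S"
    using assms by (auto simp: exits_def)
  ultimately show ?thesis
    by (auto simp: free_def)
qed

lemma free_insert_exit:
  assumes "e \<notin> S" "e = f (src e)"
  shows "free (insert e S) = free S"
  using assms by (auto simp: free_def)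

text \<open>A free arc contributes equally to both flows; an exit arc is the only arc at its tail
  when it is added, so its value is the net flow there.\<close>

lemma flow_unique:
  fixes x y :: "'e \<Rightarrow> 'a::comm_ring_1"
  assumes "exits S"
    and "\<And>i. i \<in> src ` S \<Longrightarrow> net S x i = net S y i" and "\<And>e. e \<in> free S \<Longrightarrow> x e = y e"
    and "d \<in> S"
  shows "x d = y d"
  using assms
proof (induction S arbitrary: d rule: exits_induct)
  case empty
  then show ?case by simp
next
  case (free S e)
  note fr = free_insert_free[OF free.hyps(1,3,4,5)]
  have xy: "x e = y e"
    using free.prems(2) fr by simp
  have "x e' = y e'" if "e' \<in> S" for e'
  proof (rule free.IH[OF _ _ that])
    fix i assume i: "i \<in> src ` S"
    have "net (insert e S) x i = net (insert e S) y i"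
      using i by (intro free.prems(1)) simp
    then show "net S x i = net S y i"
      using free.hyps by (simp add: net_insert xy)
  qed (use free.prems(2) fr in simp)
  then show ?case
    using free.prems(3) xy by auto
next
  case (exit S e)
  note fr = free_insert_exit[OF exit.hyps(3,4)]
  have lt: "src e < dst e"
    using exit.hyps(2) by (simp add: exits_def)
  have "net S z (src e) = 0" for z :: "'e \<Rightarrow> 'a"
    using exit.hyps(1,5) by (intro net_isolated) (fastforce simp: exits_def)
  moreover have "net (insert e S) x (src e) = net (insert e S) y (src e)"
    by (intro exit.prems(1)) simp
  ultimately have xy: "x e = y e"
    using exit.hyps lt by (simp add: net_insert)
  have "x e' = y e'" if "e' \<in> S" for e'
  proof (rule exit.IH[OF _ _ that])
    fix i assume i: "i \<in> src ` S"
    have "net (insert e S) x i = net (insert e S) y i"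
      using i by (intro exit.prems(1)) simp
    then show "net S x i = net S y i"
      using exit.hyps by (simp add: net_insert xy)
  qed (use exit.prems(2) fr in simp)
  then show ?case
    using exit.prems(3) xy by auto
qed

text \<open>The equations are triangular with units on the diagonal, hence solvable over any
  commutative ring; over the integers this gives the integral bases. The vector \<open>a\<close> is
  general because the contribution of the added arc is subtracted before the case of
  \<open>S\<close> is used.\<close>

lemma flow_exists:
  fixes y :: "'e \<Rightarrow> 'a::comm_ring_1"
  assumes "exits S"
  obtains x where "\<And>i. i \<in> src ` S \<Longrightarrow> net S x i = a i" "\<And>e. e \<in> free S \<Longrightarrow> x e = y e"
proof -
  have "\<exists>x. (\<forall>i\<in>src ` S. net S x i = a i) \<and> (\<forall>e\<in>free S. x e = y e)"
    using assms
  proof (induction S arbitrary: a rule: exits_induct)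
    case empty
    show ?case by (auto simp: free_def)
  next
    case (free S e)
    note fr = free_insert_free[OF free.hyps(1,3,4,5)]
    obtain x where x: "\<And>i. i \<in> src ` S \<Longrightarrow> net S x i = a i - y e * (of_bool (i = src e) - of_bool (i = dst e))"
      "\<And>e. e \<in> free S \<Longrightarrow> x e = y e"
      using free.IH[of "\<lambda>i. a i - y e * (of_bool (i = src e) - of_bool (i = dst e))"] by blast
    have "net (insert e S) (x(e := y e)) i = a i" if "i \<in> src ` S" for i
    proof -
      have "net S (x(e := y e)) i = net S x i"
        using free.hyps(3) by (intro net_cong) auto
      then show ?thesis
        using free.hyps(1,3) x(1)[OF that] by (simp add: net_insert)
    qed
    moreover have "src ` insert e S = src ` S"
      using free.hyps(4) by auto
    moreover have "(x(e := y e)) e' = y e'" if "e' \<in> free (insert e S)" for e'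
      using that x(2) by (auto simp: fr)
    ultimately show ?case
      by (intro exI[of _ "x(e := y e)"] conjI ballI) (simp_all only: )
  next
    case (exit S e)
    note fr = free_insert_exit[OF exit.hyps(3,4)]
    have lt: "src e < dst e"
      using exit.hyps(2) by (simp add: exits_def)
    let ?c = "a (src e)"
    obtain x where x: "\<And>i. i \<in> src ` S \<Longrightarrow> net S x i = a i - ?c * (of_bool (i = src e) - of_bool (i = dst e))"
      "\<And>e. e \<in> free S \<Longrightarrow> x e = y e"
      using exit.IH[of "\<lambda>i. a i - ?c * (of_bool (i = src e) - of_bool (i = dst e))"] by blast
    have "net S x (src e) = 0"
      using exit.hyps(1,5) by (intro net_isolated) (fastforce simp: exits_def)
    have "net (insert e S) (x(e := ?c)) i = a i" if "i \<in> insert (src e) (src ` S)" for i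
    proof -
      have "net S (x(e := ?c)) i = net S x i"
        using exit.hyps(3) by (intro net_cong) auto
      then have *: "net (insert e S) (x(e := ?c)) i = net S x i + ?c * (of_bool (i = src e) - of_bool (i = dst e))"
        using exit.hyps(1,3) by (simp add: net_insert)
      show ?thesis
      proof (cases "i = src e")
        case True
        with * lt \<open>net S x (src e) = 0\<close> show ?thesis by simp
      next
        case False
        with that have "i \<in> src ` S" by simp
        with * x(1) show ?thesis by simp
      qed
    qed
    moreover have "(x(e := ?c)) e' = y e'" if "e' \<in> free (insert e S)" for e'
      using that x(2) exit.hyps(3) free_subset by (auto simp: fr)
    ultimately show ?case
      by (intro exI[of _ "x(e := ?c)"] conjI ballI) (simp_all only: image_insert)
  qed
  then show ?thesis
    using that by blast
qed

text \<open>For a free arc \<open>k\<close> this is one unit sent through \<open>k\<close> and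
  balanced along exit arcs; no balance is asked for at the sinks.\<close>

lemma fundamental_circulations:
  assumes "exits S"
  obtains w :: "'e \<Rightarrow> 'e \<Rightarrow> int" where
    "\<And>k i. i \<in> src ` S \<Longrightarrow> net S (w k) i = 0"
    "\<And>k e. e \<in> free S \<Longrightarrow> w k e = of_bool (e = k)"
proof -
  have "\<exists>w. (\<forall>i\<in>src ` S. net S w i = 0) \<and> (\<forall>e\<in>free S. w e = (of_bool (e = k) :: int))" for k
    by (rule flow_exists[OF assms, of "\<lambda>_. 0" "\<lambda>e. of_bool (e = k)"]) blast
  then show ?thesis
    using that by metis
qed

text \<open>Both sides have the same net flows and the same free values, so uniqueness applies. The
  exit values thereby become affine functions of the free ones.\<close>

lemma flow_expansion:
  fixes x p :: "'e \<Rightarrow> 'a::comm_ring_1"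
  assumes S: "exits S"
    and w: "\<And>k i. i \<in> src ` S \<Longrightarrow> net S (w k) i = 0" "\<And>k e. e \<in> free S \<Longrightarrow> w k e = of_bool (e = k)"
    and p: "\<And>i. i \<in> src ` S \<Longrightarrow> net S p i = net S x i" "\<And>e. e \<in> free S \<Longrightarrow> p e = 0"
    and e: "e \<in> S"
  shows "x e = p e + (\<Sum>k\<in>free S. x k * w k e)"
proof (rule flow_unique[OF S _ _ e])
  fix i assume "i \<in> src ` S"
  then show "net S x i = net S (\<lambda>e. p e + (\<Sum>k\<in>free S. x k * w k e)) i"
    by (simp add: net_add net_lincomb w p)
next
  fix e assume e: "e \<in> free S"
  have "(\<Sum>k\<in>free S. x k * w k e) = (\<Sum>k\<in>free S. if e = k then x k else 0)"
    using e by (intro sum.cong) (auto simp: w)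
  then show "x e = p e + (\<Sum>k\<in>free S. x k * w k e)"
    using e S p by simp
qed

text \<open>The polytope projected to the free coordinates. The flow \<open>x\<close> is determined
  on \<open>S\<close>; as an existential witness it can be extended by an arc without formulas for
  the exit values.\<close>

definition region :: "'e set \<Rightarrow> (nat \<Rightarrow> real) \<Rightarrow> ('e \<Rightarrow> real) set" where
  "region S a = {y \<in> free S \<rightarrow>\<^sub>E UNIV. \<exists>x. (\<forall>e\<in>S. 0 \<le> x e) \<and> (\<forall>i\<in>src ` S. net S x i = a i) \<and>
     (\<forall>e\<in>free S. x e = y e)}"

text \<open>The existential form hides measurability. With the witness written as an affine function
  of \<open>y\<close>, the region is a finite intersection of closed half-spaces.\<close>

lemma region_sets [measurable]:
  assumes S: "exits S"
  shows "region S a \<in> sets (lborel_on (free S))"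
proof -
  obtain w :: "'e \<Rightarrow> 'e \<Rightarrow> int" where w: "\<And>k i. i \<in> src ` S \<Longrightarrow> net S (w k) i = 0"
    "\<And>k e. e \<in> free S \<Longrightarrow> w k e = of_bool (e = k)"
    using fundamental_circulations[OF S] by metis
  define w' where "w' k e = real_of_int (w k e)" for k e
  have w': "\<And>k i. i \<in> src ` S \<Longrightarrow> net S (w' k) i = 0"
    "\<And>k e. e \<in> free S \<Longrightarrow> w' k e = of_bool (e = k)"
    using w by (simp_all add: w'_def[abs_def] net_of_int)
  obtain p :: "'e \<Rightarrow> real" where p: "\<And>i. i \<in> src ` S \<Longrightarrow> net S p i = a i"
    "\<And>e. e \<in> free S \<Longrightarrow> p e = 0"
    using flow_exists[OF S, of a "\<lambda>_. 0"] by metis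
  have *: "(\<exists>x. (\<forall>e\<in>S. 0 \<le> x e) \<and> (\<forall>i\<in>src ` S. net S x i = a i) \<and> (\<forall>e\<in>free S. x e = y e)) \<longleftrightarrow>
      (\<forall>e\<in>S. 0 \<le> p e + (\<Sum>k\<in>free S. y k * w' k e))" (is "?L \<longleftrightarrow> ?R") for y :: "'e \<Rightarrow> real"
  proof
    assume ?L
    then obtain x where x: "\<And>e. e \<in> S \<Longrightarrow> 0 \<le> x e" "\<And>i. i \<in> src ` S \<Longrightarrow> net S x i = a i"
      "\<And>e. e \<in> free S \<Longrightarrow> x e = y e" by blast
    have "x e = p e + (\<Sum>k\<in>free S. x k * w' k e)" if "e \<in> S" for e
      by (rule flow_expansion[OF S w']) (use p x that in auto)
    then show ?R
      using x by simp
  next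
    assume R: ?R
    have "net S (\<lambda>e. p e + (\<Sum>k\<in>free S. y k * w' k e)) i = a i" if "i \<in> src ` S" for i
      using that by (simp add: net_add net_lincomb w' p)
    moreover have "p e + (\<Sum>k\<in>free S. y k * w' k e) = y e" if e: "e \<in> free S" for e
    proof -
      have "(\<Sum>k\<in>free S. y k * w' k e) = (\<Sum>k\<in>free S. if e = k then y k else 0)"
        using e by (intro sum.cong) (auto simp: w')
      then show ?thesis
        using e S p by simp
    qed
    ultimately show ?L
      using R by (intro exI[of _ "\<lambda>e. p e + (\<Sum>k\<in>free S. y k * w' k e)"]) blast
  qed
  have "region S a = {y \<in> space (lborel_on (free S)). \<forall>e\<in>S. 0 \<le> p e + (\<Sum>k\<in>free S. y k * w' k e)}"
    unfolding region_def * by simp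
  also have "\<dots> \<in> sets (lborel_on (free S))"
    using S by (intro sets.sets_Collect_finite_All) auto
  finally show ?thesis .
qed

text \<open>A slice at the value \<open>t\<close> on \<open>e\<close>: the arc moves
  \<open>t\<close> units from its tail to its head. The bound \<open>t \<le> a (src e)\<close> comes
  from the other arcs: none of them enters \<open>src e\<close>, so their net flow there is
  nonnegative.\<close>

lemma region_insert_free:
  assumes S: "exits S" "exits (insert e S)" "e \<notin> S" "src e \<in> src ` S" "e \<noteq> f (src e)"
      "\<And>e'. e' \<in> S \<Longrightarrow> src e \<le> src e'"
    and y: "y \<in> free S \<rightarrow>\<^sub>E UNIV"
  shows "y(e := t) \<in> region (insert e S) a \<longleftrightarrow>
    t \<in> {0..a (src e)} \<and> y \<in> region S (a(src e := a (src e) - t, dst e := a (dst e) + t))"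
    (is "_ \<longleftrightarrow> _ \<and> y \<in> region S ?a")
proof -
  note fr = free_insert_free[OF S(1,3,4,5)]
  have lt: "src e < dst e"
    using S(2) by (simp add: exits_def)
  have ef: "e \<notin> free S"
    using S(3) free_subset by auto
  have T: "src ` insert e S = src ` S"
    using S(4) by auto
  have net: "net (insert e S) x i = a i \<longleftrightarrow> net S x i = ?a i" if "x e = t" for x i
    using S(1,3) lt that by (auto simp: net_insert)
  have bound: "t \<le> a (src e)" if "\<And>e. e \<in> S \<Longrightarrow> 0 \<le> x e" "net S x (src e) = ?a (src e)" for x :: "'e \<Rightarrow> real"
  proof -
    have "0 \<le> net S x (src e)"
      using that S(1,6) by (intro net_nonneg) (fastforce simp: exits_def)+
    with that(2) lt show ?thesis
      by simp
  qed
  have 1: "y(e := t) \<in> free (insert e S) \<rightarrow>\<^sub>E UNIV"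
    using y by (auto simp: fr PiE_iff extensional_def)
  show ?thesis
  proof
    assume "y(e := t) \<in> region (insert e S) a"
    then obtain x where x: "\<forall>e'\<in>insert e S. 0 \<le> x e'" "\<forall>i\<in>src ` insert e S. net (insert e S) x i = a i"
      "\<forall>e'\<in>free (insert e S). x e' = (y(e := t)) e'"
      unfolding region_def by blast
    have xe: "x e = t"
      using x(3) fr by simp
    have n: "\<forall>i\<in>src ` S. net S x i = ?a i"
      using x(2) net[of x, OF xe] unfolding T by blast
    moreover have "\<forall>e'\<in>free S. x e' = y e'"
      using x(3) fr ef by auto
    ultimately have "y \<in> region S ?a"
      using x(1) y unfolding region_def by blast
    moreover have "0 \<le> t"
      using x(1) xe by auto
    moreover have "t \<le> a (src e)"
      using x(1) n S(4) by (intro bound[of x]) auto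
    ultimately show "t \<in> {0..a (src e)} \<and> y \<in> region S ?a"
      by simp
  next
    assume "t \<in> {0..a (src e)} \<and> y \<in> region S ?a"
    then obtain x where t: "0 \<le> t" and x: "\<forall>e'\<in>S. 0 \<le> x e'" "\<forall>i\<in>src ` S. net S x i = ?a i"
      "\<forall>e'\<in>free S. x e' = y e'"
      unfolding region_def by auto
    have "net S (x(e := t)) i = net S x i" for i
      using S(3) by (intro net_cong) auto
    then have "\<forall>i\<in>src ` S. net (insert e S) (x(e := t)) i = a i"
      using x(2) net[of "x(e := t)"] by simp
    moreover have "\<forall>e'\<in>insert e S. 0 \<le> (x(e := t)) e'"
      using x(1) t by auto
    moreover have "\<forall>e'\<in>free (insert e S). (x(e := t)) e' = (y(e := t)) e'"
      using x(3) fr by auto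
    ultimately show "y(e := t) \<in> region (insert e S) a"
      using 1 unfolding region_def T by blast
  qed
qed

text \<open>No arc of \<open>S\<close> touches \<open>src e\<close>, so the equation there forces
  the value on \<open>e\<close>; the sign condition on \<open>a (src e)\<close> makes this value
  admissible.\<close>

lemma region_insert_exit:
  assumes S: "exits S" "exits (insert e S)" "e \<notin> S" "e = f (src e)"
      "\<And>e'. e' \<in> S \<Longrightarrow> src e < src e'"
    and a: "0 \<le> a (src e)"
  shows "region (insert e S) a = region S (a(dst e := a (dst e) + a (src e)))" (is "_ = region S ?a")
proof -
  note fr = free_insert_exit[OF S(3,4)]
  have lt: "src e < dst e"
    using S(2) by (simp add: exits_def)
  have ef: "e \<notin> free S"
    using S(3) free_subset by auto
  have iso: "net S x (src e) = 0" for x :: "'e \<Rightarrow> real"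
    using S(1,5) by (intro net_isolated) (fastforce simp: exits_def)
  have net: "(\<forall>i\<in>src ` insert e S. net (insert e S) x i = a i) \<longleftrightarrow>
      x e = a (src e) \<and> (\<forall>i\<in>src ` S. net S x i = ?a i)" for x
    using S(1,3,5) lt by (force simp: net_insert iso)
  show ?thesis
  proof (intro set_eqI iffI)
    fix y assume "y \<in> region (insert e S) a"
    then show "y \<in> region S ?a"
      unfolding region_def net fr by blast
  next
    fix y assume "y \<in> region S ?a"
    then obtain x where y: "y \<in> free S \<rightarrow>\<^sub>E UNIV" and x: "\<forall>e'\<in>S. 0 \<le> x e'" "\<forall>i\<in>src ` S. net S x i = ?a i"
      "\<forall>e'\<in>free S. x e' = y e'"
      unfolding region_def by auto
    let ?x = "x(e := a (src e))"
    have "net S ?x i = net S x i" for i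
      using S(3) by (intro net_cong) auto
    then have "?x e = a (src e) \<and> (\<forall>i\<in>src ` S. net S ?x i = ?a i)"
      using x(2) by simp
    moreover have "\<forall>e'\<in>insert e S. 0 \<le> ?x e'"
      using x(1) a by auto
    moreover have "\<forall>e'\<in>free S. ?x e' = y e'"
      using x(3) ef by auto
    ultimately show "y \<in> region (insert e S) a"
      using y unfolding region_def net fr by blast
  qed
qed

section \<open>The volume as a sum over integral flows\<close>

text \<open>The exponent of \<open>a i\<close> contributed by the integral flow \<open>b\<close>; it is \<open>0\<close> by convention at the
  sinks. It equals \<open>t i\<close> plus the net flow of \<open>b\<close> at \<open>i\<close>.\<close>

definition expo :: "'e set \<Rightarrow> ('e \<Rightarrow> nat) \<Rightarrow> nat \<Rightarrow> int" where
  "expo S b i = (if i \<in> src ` S then net S (\<lambda>e. int (b e)) i + (\<Sum>e\<in>S. of_bool (i = src e)) - 1 else 0)"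

text \<open>An arc into a sink gets the value 0, as its head has no exponent to give away.
  Nonnegativity makes the conversion of exponents by \<open>nat\<close> exact and leaves only
  finitely many flows.\<close>

definition inner_flows :: "'e set \<Rightarrow> ('e \<Rightarrow> nat) set" where
  "inner_flows S = {b. (\<forall>e. e \<notin> S \<or> dst e \<notin> src ` S \<longrightarrow> b e = 0) \<and> (\<forall>i. 0 \<le> expo S b i)}"

text \<open>The Lidskii polynomial in divided powers, with each Kostant number unfolded into the
  flows that it counts.\<close>

definition volume_sum :: "'e set \<Rightarrow> (nat \<Rightarrow> real) \<Rightarrow> real" where
  "volume_sum S a = (\<Sum>b\<in>inner_flows S. \<Prod>i\<in>src ` S. dpow (a i) (nat (expo S b i)))"

text \<open>The new arc raises the out-degree of \<open>src e\<close> by 1 and the net flow by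
  \<open>v\<close>. If it is the first arc there, the exponent passes from its conventional value 0
  to \<open>v\<close>, because the shift by 1 absorbs the new out-degree. At a sink
  \<open>dst e\<close> the exponent is 0 before and after, which matches
  \<open>v = 0\<close>.\<close>

lemma expo_insert:
  assumes S: "exits S" "exits (insert e S)" "e \<notin> S"
    and st: "src e \<in> src ` S \<or> e = f (src e)" "\<forall>e'\<in>S. src e \<le> src e'"
    and b0: "b e = 0" and v: "dst e \<notin> src ` S \<longrightarrow> v = 0"
  shows "expo (insert e S) (b(e := v)) (src e) =
      (if src e \<in> src ` S then expo S b (src e) + 1 + int v else int v)"
    and "expo (insert e S) (b(e := v)) (dst e) = expo S b (dst e) - int v"
    and "i \<noteq> src e \<Longrightarrow> i \<noteq> dst e \<Longrightarrow> expo (insert e S) (b(e := v)) i = expo S b i"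
proof -
  have lt: "src e < dst e"
    using S(2) by (simp add: exits_def)
  have fin: "finite S"
    using S(1) by simp
  have n: "net (insert e S) (\<lambda>e'. int ((b(e := v)) e')) i =
      net S (\<lambda>e. int (b e)) i + int v * (of_bool (i = src e) - of_bool (i = dst e))" for i
  proof -
    have "net S (\<lambda>e'. int ((b(e := v)) e')) i = net S (\<lambda>e. int (b e)) i"
      using S(3) by (intro net_cong) auto
    then show ?thesis
      using fin S(3) by (simp add: net_insert)
  qed
  have o: "(\<Sum>e'\<in>insert e S. of_bool (i = src e')) = (\<Sum>e'\<in>S. of_bool (i = src e')) + (of_bool (i = src e) :: int)" for i
    using fin S(3) by simp
  have z: "net S (\<lambda>e. int (b e)) (src e) = 0 \<and> (\<Sum>e'\<in>S. of_bool (src e = src e')) = (0 :: int)"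
    if "src e \<notin> src ` S"
  proof
    have "dst e' \<noteq> src e" if "e' \<in> S" for e'
      using st(2) S(1) that by (auto simp: exits_def dest!: bspec[of S _ e'])
    then show "net S (\<lambda>e. int (b e)) (src e) = 0"
      using that by (intro net_isolated) (metis imageI)
    show "(\<Sum>e'\<in>S. of_bool (src e = src e')) = (0 :: int)"
      using that by (intro sum.neutral) auto
  qed
  show "expo (insert e S) (b(e := v)) (src e) =
      (if src e \<in> src ` S then expo S b (src e) + 1 + int v else int v)"
    using lt z unfolding expo_def n o by auto
  show "expo (insert e S) (b(e := v)) (dst e) = expo S b (dst e) - int v"
    using lt v unfolding expo_def n o by auto
  show "expo (insert e S) (b(e := v)) i = expo S b i" if "i \<noteq> src e" "i \<noteq> dst e"
    using that unfolding expo_def n o by auto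
qed

text \<open>At the smallest tail no arc enters, so the net flow is nonnegative, and at least one arc
  leaves, which makes up for the shift by 1.\<close>

lemma expo_src_nonneg:
  assumes "exits S" "i \<in> src ` S" "\<And>e. e \<in> S \<Longrightarrow> i \<le> src e"
  shows "0 \<le> expo S b i"
proof -
  have "dst e \<noteq> i" if "e \<in> S" for e
    using assms(1,3) that by (fastforce simp: exits_def)
  then have nn: "0 \<le> net S (\<lambda>e. int (b e)) i"
    by (intro net_nonneg) auto
  obtain e where e: "e \<in> S" "src e = i"
    using assms(2) by auto
  have "(1::int) = (\<Sum>e'\<in>{e}. of_bool (i = src e'))"
    using e by simp
  also have "\<dots> \<le> (\<Sum>e'\<in>S. of_bool (i = src e'))"
    using e assms(1) by (intro sum_mono2) auto
  finally have "(1::int) \<le> (\<Sum>e'\<in>S. of_bool (i = src e'))" .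
  with nn show ?thesis
    by (simp add: expo_def assms(2))
qed

text \<open>The value on \<open>e\<close> is the part of the exponent of \<open>dst e\<close> that
  is handed to \<open>src e\<close>, so it ranges from 0 to that exponent. The inverse map records
  this value and erases it.\<close>

lemma inner_flows_insert:
  assumes S: "exits S" "exits (insert e S)" "e \<notin> S"
    and st: "src e \<in> src ` S \<or> e = f (src e)" "\<forall>e'\<in>S. src e \<le> src e'"
  shows "bij_betw (\<lambda>(b, v). b(e := v)) (Sigma (inner_flows S) (\<lambda>b. {..nat (expo S b (dst e))}))
    (inner_flows (insert e S))"
proof (rule bij_betwI[where g = "\<lambda>b. (b(e := 0), b e)"])
  have lt: "src e < dst e"
    using S(2) by (simp add: exits_def)
  have up: "dst e' \<noteq> src e" if "e' \<in> insert e S" for e'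
  proof -
    have "src e \<le> src e'" "src e' < dst e'"
      using st(2) S(2) that by (auto simp: exits_def)
    then show ?thesis
      by simp
  qed
  have sink: "expo S b (dst e) = 0" if "dst e \<notin> src ` S" for b
    using that by (simp add: expo_def)
  have e0: "b e = 0" if "b \<in> inner_flows S" for b
    using that S(3) by (simp add: inner_flows_def)
  show "(\<lambda>(b, v). b(e := v)) \<in> Sigma (inner_flows S) (\<lambda>b. {..nat (expo S b (dst e))}) \<rightarrow> inner_flows (insert e S)"
  proof
    fix z assume "z \<in> Sigma (inner_flows S) (\<lambda>b. {..nat (expo S b (dst e))})"
    then obtain b v where z: "z = (b, v)" and b: "b \<in> inner_flows S"
      and v: "v \<in> {..nat (expo S b (dst e))}"
      by blast
    have nn: "0 \<le> expo S b i" for i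
      using b by (simp add: inner_flows_def)
    have v0: "dst e \<notin> src ` S \<longrightarrow> v = 0"
      using v sink by auto
    note ex = expo_insert[where b = b and v = v, OF S st e0[OF b] v0]
    have "0 \<le> expo (insert e S) (b(e := v)) i" for i
    proof -
      consider "i = src e" | "i = dst e" | "i \<noteq> src e" "i \<noteq> dst e" by blast
      then show ?thesis
      proof cases
        case 1
        then show ?thesis using ex(1) nn[of i] by simp
      next
        case 2
        then show ?thesis using ex(2) nn[of i] v by simp
      next
        case 3
        then show ?thesis using ex(3)[OF 3] nn[of i] by simp
      qed
    qed
    moreover have "(b(e := v)) e' = 0" if "e' \<notin> insert e S \<or> dst e' \<notin> src ` insert e S" for e'
      using that b v0 by (auto simp: inner_flows_def)
    ultimately have "b(e := v) \<in> inner_flows (insert e S)"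
      unfolding inner_flows_def by blast
    then show "(case z of (b, v) \<Rightarrow> b(e := v)) \<in> inner_flows (insert e S)"
      by (simp add: z)
  qed
  show "(\<lambda>b. (b(e := 0), b e)) \<in> inner_flows (insert e S) \<rightarrow> Sigma (inner_flows S) (\<lambda>b. {..nat (expo S b (dst e))})"
  proof
    fix b assume b: "b \<in> inner_flows (insert e S)"
    have nn: "0 \<le> expo (insert e S) b i" for i
      using b by (simp add: inner_flows_def)
    have v0: "dst e \<notin> src ` S \<longrightarrow> b e = 0"
      using b lt by (auto simp: inner_flows_def)
    have "b(e := 0, e := b e) = b"
      by simp
    note ex = expo_insert[where b = "b(e := 0)" and v = "b e", OF S st fun_upd_same v0, unfolded this]
    have d: "int (b e) \<le> expo S (b(e := 0)) (dst e)"
      using ex(2) nn[of "dst e"] by simp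
    have "0 \<le> expo S (b(e := 0)) i" for i
    proof -
      consider "i = src e" "i \<in> src ` S" | "i = src e" "i \<notin> src ` S" | "i = dst e" | "i \<noteq> src e" "i \<noteq> dst e" by blast
      then show ?thesis
      proof cases
        case 1
        \<comment> \<open>Erasing \<open>e\<close> lowers the exponent at \<open>src e\<close>, so
          its sign cannot be read off from \<open>b\<close>; minimality of the tail supplies
          it.\<close>
        then show ?thesis using expo_src_nonneg[OF S(1)] st(2) by simp
      next
        case 2
        then show ?thesis by (simp add: expo_def)
      next
        case 3
        then show ?thesis using d by simp
      next
        case 4
        then show ?thesis using ex(3)[OF 4] nn[of i] by simp
      qed
    qed
    moreover have "(b(e := 0)) e' = 0" if "e' \<notin> S \<or> dst e' \<notin> src ` S" for e'
      using that b up[of e'] by (auto simp: inner_flows_def)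
    ultimately show "(b(e := 0), b e) \<in> Sigma (inner_flows S) (\<lambda>b. {..nat (expo S b (dst e))})"
      using d by (simp add: inner_flows_def)
  qed
qed (auto simp: inner_flows_def S(3))

lemma finite_inner_flows [simp]: "exits S \<Longrightarrow> finite (inner_flows S)"
proof (induction S rule: exits_induct)
  case empty
  have "inner_flows {} \<subseteq> {\<lambda>_. 0}"
    by (auto simp: inner_flows_def)
  then show ?case
    by (rule finite_subset) simp
next
  case (free S e)
  then show ?case
    using bij_betw_finite[OF inner_flows_insert[of S e]] by auto
next
  case (exit S e)
  then show ?case
    using bij_betw_finite[OF inner_flows_insert[of S e]] by (auto intro: less_imp_le)
qed

lemma volume_sum_nonneg: "(\<And>i. 0 \<le> a i) \<Longrightarrow> 0 \<le> volume_sum S a"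
  unfolding volume_sum_def by (intro sum_nonneg prod_nonneg ballI dpow_nonneg)

text \<open>Flows are grouped by their values on \<open>S\<close>. The inner sum is the polynomial
  produced by integration if an arc of \<open>S\<close> leaves \<open>src e\<close>, and a binomial
  sum if \<open>e\<close> is alone there; \<open>Suc\<close> is the degree gained by
  integrating.\<close>

lemma volume_sum_insert:
  assumes S: "exits S" "exits (insert e S)" "e \<notin> S"
    and st: "src e \<in> src ` S \<or> e = f (src e)" "\<forall>e'\<in>S. src e \<le> src e'"
  shows "volume_sum (insert e S) a = (\<Sum>b\<in>inner_flows S.
    (\<Prod>i\<in>src ` S - {src e, dst e}. dpow (a i) (nat (expo S b i))) *
    (\<Sum>v\<le>nat (expo S b (dst e)).
      dpow (a (src e)) ((if src e \<in> src ` S then Suc (nat (expo S b (src e))) else 0) + v) *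
      dpow (a (dst e)) (nat (expo S b (dst e)) - v)))"
proof -
  have lt: "src e < dst e"
    using S(2) by (simp add: exits_def)
  let ?T = "src ` insert e S"
  have finT: "finite ?T"
    using S(1) by simp
  have "volume_sum (insert e S) a = (\<Sum>(b, v)\<in>Sigma (inner_flows S) (\<lambda>b. {..nat (expo S b (dst e))}).
      \<Prod>i\<in>?T. dpow (a i) (nat (expo (insert e S) (b(e := v)) i)))"
    unfolding volume_sum_def
    by (subst sum.reindex_bij_betw[OF inner_flows_insert[OF S st], symmetric])
      (auto intro!: sum.cong)
  also have "\<dots> = (\<Sum>b\<in>inner_flows S. \<Sum>v\<le>nat (expo S b (dst e)).
      \<Prod>i\<in>?T. dpow (a i) (nat (expo (insert e S) (b(e := v)) i)))"
    using S(1) by (subst sum.Sigma) auto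
  also have "\<dots> = (\<Sum>b\<in>inner_flows S. \<Sum>v\<le>nat (expo S b (dst e)).
    (\<Prod>i\<in>src ` S - {src e, dst e}. dpow (a i) (nat (expo S b i))) *
      (dpow (a (src e)) ((if src e \<in> src ` S then Suc (nat (expo S b (src e))) else 0) + v) *
      dpow (a (dst e)) (nat (expo S b (dst e)) - v)))"
  proof (intro sum.cong refl)
    fix b v assume b: "b \<in> inner_flows S" and v: "v \<in> {..nat (expo S b (dst e))}"
    have nn: "0 \<le> expo S b i" for i
      using b by (simp add: inner_flows_def)
    have b0: "b e = 0"
      using b S(3) by (simp add: inner_flows_def)
    have v0: "dst e \<notin> src ` S \<longrightarrow> v = 0"
      using v by (auto simp: expo_def)
    note ex = expo_insert[where b = b and v = v, OF S st b0 v0]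
    define g where "g i = dpow (a i) (nat (expo (insert e S) (b(e := v)) i))" for i
    have gh: "g (dst e) = dpow (a (dst e)) (nat (expo S b (dst e)) - v)"
      unfolding g_def ex(2) using nn[of "dst e"] v by (simp add: nat_diff_distrib)
    have gs: "g (src e) = dpow (a (src e)) ((if src e \<in> src ` S then Suc (nat (expo S b (src e))) else 0) + v)"
      unfolding g_def ex(1) using nn[of "src e"]
      by (auto simp: nat_add_distrib intro!: arg_cong[where f = "dpow (a (src e))"])
    have "(\<Prod>i\<in>?T. g i) = g (src e) * (\<Prod>i\<in>?T - {src e}. g i)"
      using finT by (intro prod.remove) auto
    also have "(\<Prod>i\<in>?T - {src e}. g i) = g (dst e) * (\<Prod>i\<in>?T - {src e} - {dst e}. g i)"
    proof (cases "dst e \<in> ?T")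
      case True
      then show ?thesis
        using finT lt by (intro prod.remove) auto
    next
      case False
      then have "g (dst e) = 1"
        unfolding g_def by (simp add: expo_def)
      with False show ?thesis by simp
    qed
    also have "?T - {src e} - {dst e} = src ` S - {src e, dst e}"
      by auto
    also have "(\<Prod>i\<in>\<dots>. g i) = (\<Prod>i\<in>src ` S - {src e, dst e}. dpow (a i) (nat (expo S b i)))"
      unfolding g_def using ex(3) by (intro prod.cong) auto
    finally show "(\<Prod>i\<in>?T. dpow (a i) (nat (expo (insert e S) (b(e := v)) i))) =
      (\<Prod>i\<in>src ` S - {src e, dst e}. dpow (a i) (nat (expo S b i))) *
      (dpow (a (src e)) ((if src e \<in> src ` S then Suc (nat (expo S b (src e))) else 0) + v) *
      dpow (a (dst e)) (nat (expo S b (dst e)) - v))"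
      unfolding g_def[symmetric] gh gs by (simp add: mult_ac)
  qed
  finally show ?thesis
    by (simp add: sum_distrib_left)
qed

text \<open>The counterpart for the smaller arc set and the changed vector, in which only two
  factors differ. A vertex without outgoing arcs has exponent 0 and factor 1, so the product can be
  extended to \<open>i\<close> and \<open>j\<close> in all cases.\<close>

lemma volume_sum_split:
  assumes S: "exits S" and ij: "i \<noteq> j" "\<And>k. k \<noteq> i \<Longrightarrow> k \<noteq> j \<Longrightarrow> a' k = a k"
  shows "volume_sum S a' = (\<Sum>b\<in>inner_flows S. (\<Prod>k\<in>src ` S - {i, j}. dpow (a k) (nat (expo S b k))) *
     (dpow (a' i) (nat (expo S b i)) * dpow (a' j) (nat (expo S b j))))"
  unfolding volume_sum_def
proof (intro sum.cong refl)
  fix b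
  define g where "g k = dpow (a' k) (nat (expo S b k))" for k
  have g1: "g k = 1" if "k \<notin> src ` S" for k
    using that by (simp add: g_def expo_def)
  have "(\<Prod>k\<in>src ` S. g k) = (\<Prod>k\<in>src ` S \<union> {i, j}. g k)"
    using S g1 by (intro prod.mono_neutral_left) auto
  also have "\<dots> = (\<Prod>k\<in>(src ` S - {i, j}) \<union> {i, j}. g k)"
    by (simp add: Un_commute)
  also have "\<dots> = (\<Prod>k\<in>src ` S - {i, j}. g k) * (\<Prod>k\<in>{i, j}. g k)"
    using S by (intro prod.union_disjoint) auto
  also have "(\<Prod>k\<in>src ` S - {i, j}. g k) = (\<Prod>k\<in>src ` S - {i, j}. dpow (a k) (nat (expo S b k)))"
    unfolding g_def using ij by (intro prod.cong) auto
  finally show "(\<Prod>k\<in>src ` S. dpow (a' k) (nat (expo S b k))) =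
     (\<Prod>k\<in>src ` S - {i, j}. dpow (a k) (nat (expo S b k))) *
     (dpow (a' i) (nat (expo S b i)) * dpow (a' j) (nat (expo S b j)))"
    using ij by (simp add: g_def)
qed

theorem emeasure_region:
  assumes "exits S" "\<And>i. 0 \<le> a i"
  shows "emeasure (lborel_on (free S)) (region S a) = ennreal (volume_sum S a)"
  using assms
proof (induction S arbitrary: a rule: exits_induct)
  case empty
  have "region {} a = (\<Pi>\<^sub>E e\<in>{}. UNIV)"
    by (auto simp: region_def free_def)
  moreover have "emeasure (lborel_on {}) (\<Pi>\<^sub>E e\<in>{}. UNIV) = 1"
    by (subst lborel_on.emeasure_PiM) auto
  moreover have "inner_flows {} = {\<lambda>_. 0}"
    by (auto simp: inner_flows_def expo_def)
  ultimately show ?case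
    by (simp add: free_def volume_sum_def)
next
  case (free S e)
  note S = free.hyps(1-6)
  note fr = free_insert_free[OF S(1,3,4,5)]
  have ef: "e \<notin> free S"
    using S(3) free_subset by auto
  have lt: "src e < dst e"
    using S(2) by (simp add: exits_def)
  define s h where "s = a (src e)" and "h = a (dst e)"
  have sh: "0 \<le> s" "0 \<le> h"
    using free.prems by (simp_all add: s_def h_def)
  define a' where "a' t = a(src e := s - t, dst e := h + t)" for t
  define c where "c b = (\<Prod>k\<in>src ` S - {src e, dst e}. dpow (a k) (nat (expo S b k)))" for b
  define p q where "p b = nat (expo S b (src e))" and "q b = nat (expo S b (dst e))" for b
  \<comment> \<open>Of all antiderivatives, this one has a positive power of \<open>s - t\<close> in
    each summand; hence \<open>F s = 0\<close> and the integral is \<open>- F 0\<close>.\<close>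
  define F where "F t = (\<Sum>b\<in>inner_flows S. c b *
      - (\<Sum>v\<le>q b. dpow (s - t) (Suc (p b + v)) * dpow (h + t) (q b - v)))" for t
  have vol: "volume_sum S (a' t) = (\<Sum>b\<in>inner_flows S. c b * (dpow (s - t) (p b) * dpow (h + t) (q b)))" for t
    unfolding c_def p_def q_def using lt
    by (subst volume_sum_split[OF S(1), of "src e" "dst e" _ a]) (auto simp: a'_def)
  have dF: "DERIV F t :> volume_sum S (a' t)" for t
    unfolding F_def vol by (intro DERIV_sum DERIV_cmult DERIV_dpow_convolution)
  have a'_nn: "0 \<le> a' t i" if "t \<in> {0..s}" for t i
    using that free.prems sh by (auto simp: a'_def)
  have "emeasure (lborel_on (free (insert e S))) (region (insert e S) a) =
      (\<integral>\<^sup>+y. indicator (region (insert e S) a) y \<partial>lborel_on (insert e (free S)))"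
    using region_sets[OF S(2), of a] by (simp add: fr)
  also have "\<dots> = (\<integral>\<^sup>+t. (\<integral>\<^sup>+y. indicator (region (insert e S) a) (y(e := t)) \<partial>lborel_on (free S)) \<partial>lborel)"
    using S(1) ef region_sets[OF S(2), of a] by (intro lborel_on.product_nn_integral_insert_rev) (auto simp: fr)
  also have "\<dots> = (\<integral>\<^sup>+t. ennreal (volume_sum S (a' t)) * indicator {0..s} t \<partial>lborel)"
  proof (rule nn_integral_cong)
    fix t :: real
    have "(\<integral>\<^sup>+y. indicator (region (insert e S) a) (y(e := t)) \<partial>lborel_on (free S)) =
        (\<integral>\<^sup>+y. indicator {0..s} t * indicator (region S (a' t)) y \<partial>lborel_on (free S))"
    proof (rule nn_integral_cong)
      fix y assume "y \<in> space (lborel_on (free S))"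
      then show "indicator (region (insert e S) a) (y(e := t)) =
          (indicator {0..s} t * indicator (region S (a' t)) y :: ennreal)"
        using region_insert_free[OF S, of y t a] unfolding a'_def s_def h_def
        by (auto simp: indicator_def simp del: fun_upd_apply)
    qed
    also have "\<dots> = indicator {0..s} t * emeasure (lborel_on (free S)) (region S (a' t))"
      using region_sets[OF S(1)] by (simp add: nn_integral_cmult_indicator)
    also have "\<dots> = ennreal (volume_sum S (a' t)) * indicator {0..s} t"
      using free.IH[of "a' t"] a'_nn by (auto simp: indicator_def)
    finally show "(\<integral>\<^sup>+y. indicator (region (insert e S) a) (y(e := t)) \<partial>lborel_on (free S)) =
        ennreal (volume_sum S (a' t)) * indicator {0..s} t" .
  qed
  also have "\<dots> = ennreal (F s - F 0)"
  proof (rule nn_integral_FTC_Icc)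
    have "continuous_on UNIV (\<lambda>t. volume_sum S (a' t))"
      unfolding vol dpow_def by (intro continuous_intros) auto
    then show "(\<lambda>t. volume_sum S (a' t)) \<in> borel_measurable borel"
      by (rule borel_measurable_continuous_onI)
  qed (use dF a'_nn sh in \<open>auto intro!: volume_sum_nonneg\<close>)
  also have "F s = 0"
    unfolding F_def by (simp add: dpow_zero)
  also have "0 - F 0 = volume_sum (insert e S) a"
  proof -
    have "volume_sum (insert e S) a =
        (\<Sum>b\<in>inner_flows S. c b * (\<Sum>v\<le>q b. dpow s (Suc (p b + v)) * dpow h (q b - v)))"
      unfolding c_def p_def q_def s_def h_def
      using S(4,6) by (subst volume_sum_insert[OF S(1-3)]) auto
    then show ?thesis
      by (simp add: F_def sum_negf)
  qed
  finally show ?case .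
next
  case (exit S e)
  note S = exit.hyps(1-5)
  note fr = free_insert_exit[OF S(3,4)]
  have lt: "src e < dst e"
    using S(2) by (simp add: exits_def)
  have ns: "src e \<notin> src ` S"
    using S(5) by fastforce
  define a' where "a' = a(dst e := a (dst e) + a (src e))"
  have "volume_sum (insert e S) a = (\<Sum>b\<in>inner_flows S.
    (\<Prod>i\<in>src ` S - {src e, dst e}. dpow (a i) (nat (expo S b i))) *
    (\<Sum>v\<le>nat (expo S b (dst e)). dpow (a (src e)) v * dpow (a (dst e)) (nat (expo S b (dst e)) - v)))"
    using S(4,5) ns by (subst volume_sum_insert[OF S(1-3)]) (auto intro: less_imp_le)
  \<comment> \<open>As \<open>src e\<close> is not a tail in \<open>S\<close>, its factor is 1, and
    the sum over \<open>v\<close> is the divided power of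
    \<open>a (dst e) + a (src e)\<close>.\<close>
  also have "\<dots> = volume_sum S a'"
    using ns lt
    by (subst volume_sum_split[OF S(1), of "src e" "dst e" _ a])
       (auto simp: a'_def dpow_add[symmetric] expo_def add.commute intro!: sum.cong)
  finally have "volume_sum (insert e S) a = volume_sum S a'" .
  moreover have "region (insert e S) a = region S a'"
    unfolding a'_def using exit.prems by (intro region_insert_exit S)
  moreover have "0 \<le> a' i" for i
    using exit.prems by (simp add: a'_def)
  ultimately show ?case
    using exit.IH[of a'] by (simp add: fr)
qed

end

section \<open>The chart given by the free arcs\<close>

context exit_choice
begin

definition flows :: "'e set \<Rightarrow> (nat \<Rightarrow> real) \<Rightarrow> ('e \<Rightarrow> real) set" where
  "flows S a = {x \<in> S \<rightarrow>\<^sub>E UNIV. \<forall>i\<in>src ` S. net S x i = a i}"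

lemma net_restrict [simp]: "net S (restrict x S) = net S x"
  by (rule ext, rule net_cong) simp

text \<open>The fundamental circulations of the free arcs form a basis: each coefficient is the
  value on the chord, an integer for integral flows. Existence is what makes the choice in
  \<open>lattice_volume\<close> meet its specification.\<close>

lemma integer_lattice_basis_exists:
  assumes S: "exits S"
  shows "\<exists>w. integer_lattice_basis S (flows S (\<lambda>_. 0)) (card (free S)) w"
proof -
  define d where "d = card (free S)"
  obtain w :: "'e \<Rightarrow> 'e \<Rightarrow> int" where w: "\<And>k i. i \<in> src ` S \<Longrightarrow> net S (w k) i = 0"
    "\<And>k e. e \<in> free S \<Longrightarrow> w k e = of_bool (e = k)"
    using fundamental_circulations[OF S] by metis
  define w' where "w' k e = real_of_int (w k e)" for k e
  have w': "\<And>k i. i \<in> src ` S \<Longrightarrow> net S (w' k) i = 0"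
    "\<And>k e. e \<in> free S \<Longrightarrow> w' k e = of_bool (e = k)"
    using w by (simp_all add: w'_def[abs_def] net_of_int)
  obtain g where g: "bij_betw g {..<d} (free S)"
    using ex_bij_betw_nat_finite[OF finite_free[OF S]] by (auto simp: d_def lessThan_atLeast0)
  have gf: "g i \<in> free S" if "i < d" for i
    using g that by (auto simp: bij_betw_def)
  have gi: "g i = g j \<longleftrightarrow> i = j" if "i < d" "j < d" for i j
    using g that by (auto simp: bij_betw_def inj_on_def)
  have comb: "(\<Sum>i<d. of_int (c i) * restrict (w' (g i)) S (g j)) = real_of_int (c j)" if j: "j < d" for c :: "nat \<Rightarrow> int" and j
  proof -
    have "g j \<in> S"
      using gf[OF j] free_subset by auto
    then have "(\<Sum>i<d. of_int (c i) * restrict (w' (g i)) S (g j)) = (\<Sum>i<d. if j = i then real_of_int (c i) else 0)"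
      using j gf[OF j] by (intro sum.cong) (auto simp: w' gi)
    then show ?thesis
      using j by simp
  qed
  have "integer_lattice_basis S (flows S (\<lambda>_. 0)) d (\<lambda>i. restrict (w' (g i)) S)"
    unfolding integer_lattice_basis_def
  proof (intro conjI allI impI ballI)
    fix i
    show "restrict (w' (g i)) S \<in> flows S (\<lambda>_. 0) \<inter> (S \<rightarrow>\<^sub>E \<int>)"
      unfolding flows_def by (auto simp: w' w'_def[of _ "_ :: 'e"])
  next
    fix z assume z: "z \<in> flows S (\<lambda>_. 0) \<inter> (S \<rightarrow>\<^sub>E \<int>)"
    have zf: "of_int \<lfloor>z e\<rfloor> = z e" if "e \<in> S" for e
      using z that by (auto simp: PiE_iff)
    define c where "c = (\<lambda>i\<in>{..<d}. \<lfloor>z (g i)\<rfloor>)"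
    have rep: "z e = (\<Sum>i<d. of_int (c i) * restrict (w' (g i)) S e)" if e: "e \<in> S" for e
    proof -
      have "z e = 0 + (\<Sum>k\<in>free S. z k * w' k e)"
        using z by (intro flow_expansion[OF S w' _ _ e]) (auto simp: flows_def net_def)
      also have "\<dots> = (\<Sum>i<d. z (g i) * w' (g i) e)"
        using sum.reindex_bij_betw[OF g, of "\<lambda>k. z k * w' k e"] by simp
      also have "\<dots> = (\<Sum>i<d. of_int (c i) * restrict (w' (g i)) S e)"
        using e gf free_subset by (intro sum.cong refl) (auto simp: c_def zf subset_iff)
      finally show ?thesis .
    qed
    have uniq: "c' = c" if c': "c' \<in> {..<d} \<rightarrow>\<^sub>E UNIV"
      and eq: "\<And>e. e \<in> S \<Longrightarrow> z e = (\<Sum>i<d. of_int (c' i) * restrict (w' (g i)) S e)" for c' :: "nat \<Rightarrow> int"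
    proof
      fix j
      show "c' j = c j"
      proof (cases "j < d")
        case True
        have "g j \<in> S"
          using gf[OF True] free_subset by auto
        then have "z (g j) = of_int (c' j)"
          unfolding comb[OF True, symmetric] by (rule eq)
        then show ?thesis
          using True by (simp add: c_def)
      next
        case False
        then show ?thesis
          using c' by (auto simp: c_def PiE_iff extensional_def)
      qed
    qed
    have "c \<in> {..<d} \<rightarrow>\<^sub>E UNIV"
      by (simp add: c_def)
    then show "\<exists>!c. c \<in> {..<d} \<rightarrow>\<^sub>E (UNIV :: int set) \<and>
        (\<forall>e\<in>S. z e = (\<Sum>i<d. of_int (c i) * restrict (w' (g i)) S e))"
      by (intro ex1I[of _ c] conjI ballI rep) (auto intro!: uniq)
  qed
  then show ?thesis
    unfolding d_def by blast
qed

text \<open>The chart is arbitrary. Fundamental circulations expand integrally in the given basis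
  with coefficients \<open>u\<close>, and the basis expands in them with its free values
  \<open>wi\<close> as coefficients. So \<open>u\<close> and \<open>wi\<close> are mutually inverse,
  and passing to free coordinates is \<open>U.T\<close> followed by a translation by
  \<open>p\<close>.\<close>

lemma emeasure_chart:
  assumes S: "exits S" and p: "p \<in> flows S a"
    and basis: "integer_lattice_basis S (flows S (\<lambda>_. 0)) d w"
  shows "emeasure (lborel_on {..<d})
      {x \<in> {..<d} \<rightarrow>\<^sub>E UNIV. (\<lambda>e\<in>S. p e + (\<Sum>i<d. x i * w i e)) \<in> {x \<in> flows S a. \<forall>e\<in>S. 0 \<le> x e}} =
    emeasure (lborel_on (free S)) (region S a)"
proof -
  let ?V = "flows S (\<lambda>_. 0) \<inter> (S \<rightarrow>\<^sub>E \<int>)"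
  have wV: "w i \<in> ?V" if "i < d" for i
    using basis that by (simp add: integer_lattice_basis_def)
  have wnet: "net S (w i) j = 0" if "i < d" "j \<in> src ` S" for i j
    using wV[OF that(1)] that(2) by (auto simp: flows_def)
  have ex1: "\<exists>!c. c \<in> {..<d} \<rightarrow>\<^sub>E (UNIV :: int set) \<and> (\<forall>e\<in>S. z e = (\<Sum>i<d. of_int (c i) * w i e))"
    if "z \<in> ?V" for z
    using basis that by (simp add: integer_lattice_basis_def)
  obtain v :: "'e \<Rightarrow> 'e \<Rightarrow> int" where v: "\<And>k i. i \<in> src ` S \<Longrightarrow> net S (v k) i = 0"
    "\<And>k e. e \<in> free S \<Longrightarrow> v k e = of_bool (e = k)"
    using fundamental_circulations[OF S] by metis
  define v' where "v' k e = real_of_int (v k e)" for k e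
  have v': "\<And>k i. i \<in> src ` S \<Longrightarrow> net S (v' k) i = 0"
    "\<And>k e. e \<in> free S \<Longrightarrow> v' k e = of_bool (e = k)"
    using v by (simp_all add: v'_def[abs_def] net_of_int)
  have "restrict (v' k) S \<in> ?V" for k
    unfolding flows_def by (auto simp: v' v'_def[of _ "_ :: 'e"])
  from ex1[OF this] have "\<exists>c :: nat \<Rightarrow> int. \<forall>e\<in>S. v' k e = (\<Sum>i<d. of_int (c i) * w i e)" for k
    by fastforce
  then obtain u :: "'e \<Rightarrow> nat \<Rightarrow> int" where u: "\<And>k e. e \<in> S \<Longrightarrow> v' k e = (\<Sum>i<d. of_int (u k i) * w i e)"
    by metis
  define wi where "wi i e = \<lfloor>w i e\<rfloor>" for i e
  have wi: "real_of_int (wi i e) = w i e" if "i < d" "e \<in> S" for i e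
    using wV[OF that(1)] that(2) by (auto simp: wi_def PiE_iff)
  have fS: "e \<in> S" if "e \<in> free S" for e
    using that free_subset by auto
  interpret U: unimodular "{..<d}" "free S" wi u
  proof
    show "finite (free S)"
      using S by simp
    fix j j' assume j: "j \<in> free S" "j' \<in> free S"
    have "real_of_int (\<Sum>i<d. u j i * wi i j') = (\<Sum>i<d. of_int (u j i) * w i j')"
      using j by (simp add: wi fS)
    also have "\<dots> = real_of_int (of_bool (j = j'))"
      using u[of j' j] j by (auto simp: fS v')
    finally show "(\<Sum>i<d. u j i * wi i j') = of_bool (j = j')"
      by (simp only: of_int_eq_iff)
  next
    fix i i' assume i: "i \<in> {..<d}" "i' \<in> {..<d}"
    \<comment> \<open>Substituting one expansion into the other gives a second coefficient vector
      for \<open>w i\<close>; uniqueness of coefficients equates it with the unit vector.\<close>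
    define c1 where "c1 = (\<lambda>k\<in>{..<d}. of_bool (i = k) :: int)"
    define c2 where "c2 = (\<lambda>k\<in>{..<d}. \<Sum>j\<in>free S. wi i j * u j k)"
    have "w i e = (\<Sum>k<d. of_int (c1 k) * w k e)" for e
    proof -
      have "(\<Sum>k<d. of_int (c1 k) * w k e) = (\<Sum>k<d. if i = k then w k e else 0)"
        by (intro sum.cong) (auto simp: c1_def)
      then show ?thesis
        using i by simp
    qed
    moreover have "w i e = (\<Sum>k<d. of_int (c2 k) * w k e)" if e: "e \<in> S" for e
    proof -
      have "w i e = 0 + (\<Sum>j\<in>free S. w i j * v' j e)"
        using i wnet by (intro flow_expansion[OF S v' _ _ e]) (auto simp: net_def)
      also have "\<dots> = (\<Sum>j\<in>free S. \<Sum>k<d. w i j * (of_int (u j k) * w k e))"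
        by (simp add: u[OF e] sum_distrib_left)
      also have "\<dots> = (\<Sum>k<d. \<Sum>j\<in>free S. w i j * (of_int (u j k) * w k e))"
        by (rule sum.swap)
      also have "\<dots> = (\<Sum>k<d. of_int (c2 k) * w k e)"
        using i by (intro sum.cong refl) (simp add: c2_def wi fS sum_distrib_right mult.assoc)
      finally show ?thesis .
    qed
    moreover have "c1 \<in> {..<d} \<rightarrow>\<^sub>E UNIV" "c2 \<in> {..<d} \<rightarrow>\<^sub>E UNIV"
      by (simp_all add: c1_def c2_def)
    ultimately have "c1 = c2"
      using ex1[OF wV[of i]] i by blast
    then have "c2 i' = c1 i'"
      by simp
    then show "(\<Sum>j\<in>free S. wi i j * u j i') = of_bool (i = i')"
      using i by (simp add: c1_def c2_def)
  qed simp
  define B where "B = {y \<in> free S \<rightarrow>\<^sub>E UNIV. (\<lambda>j\<in>free S. y j + p j) \<in> region S a}"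
  have reg: "region S a \<in> sets (lborel_on (free S))"
    by (rule region_sets[OF S])
  have "(\<lambda>y. \<lambda>j\<in>free S. y j + p j) \<in> lborel_on (free S) \<rightarrow>\<^sub>M lborel_on (free S)"
    by measurable
  from measurable_sets[OF this reg] have B: "B \<in> sets (lborel_on (free S))"
    unfolding B_def by (simp add: Int_def vimage_def conj_commute)
  have "{x \<in> {..<d} \<rightarrow>\<^sub>E UNIV. (\<lambda>e\<in>S. p e + (\<Sum>i<d. x i * w i e)) \<in> {x \<in> flows S a. \<forall>e\<in>S. 0 \<le> x e}} =
      {x \<in> {..<d} \<rightarrow>\<^sub>E UNIV. U.T x \<in> B}"
  proof (intro Collect_cong conj_cong refl)
    fix x :: "nat \<Rightarrow> real"
    define X where "X e = p e + (\<Sum>i<d. x i * w i e)" for e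
    have X: "net S X j = a j" if "j \<in> src ` S" for j
          proof -
      have "net S p j = a j"
        using p that unfolding flows_def by blast
      then show ?thesis
        unfolding X_def using that by (simp add: net_add net_lincomb wnet)
    qed
    then have "restrict X S \<in> flows S a"
      unfolding flows_def by simp
    moreover have TX: "(\<lambda>j\<in>free S. U.T x j + p j) = restrict X (free S)"
      by (auto simp: U.T_def X_def wi fS)
    moreover have "restrict X (free S) \<in> region S a \<longleftrightarrow> (\<forall>e\<in>S. 0 \<le> X e)"
    proof
      assume "restrict X (free S) \<in> region S a"
      then obtain x' where x': "\<And>e. e \<in> S \<Longrightarrow> 0 \<le> x' e" "\<And>i. i \<in> src ` S \<Longrightarrow> net S x' i = a i"
        "\<And>e. e \<in> free S \<Longrightarrow> x' e = X e"
        unfolding region_def by auto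
      have "x' e = X e" if "e \<in> S" for e
      proof (rule flow_unique[OF S _ _ that])
        fix i assume "i \<in> src ` S"
        then show "net S x' i = net S X i"
          by (simp only: x'(2) X)
      qed (rule x'(3))
      then show "\<forall>e\<in>S. 0 \<le> X e"
        using x'(1) by metis
    next
      assume "\<forall>e\<in>S. 0 \<le> X e"
      then show "restrict X (free S) \<in> region S a"
        using X unfolding region_def by (intro CollectI conjI exI[of _ X]) auto
    qed
    ultimately show "(\<lambda>e\<in>S. p e + (\<Sum>i<d. x i * w i e)) \<in> {x \<in> flows S a. \<forall>e\<in>S. 0 \<le> x e} \<longleftrightarrow>
        U.T x \<in> B"
      unfolding B_def X_def[symmetric] by (simp del: restrict_apply) simp
  qed
  also have "emeasure (lborel_on {..<d}) \<dots> = emeasure (lborel_on (free S)) B"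
    by (rule U.emeasure_preimage[OF B])
  also have "\<dots> = emeasure (lborel_on (free S)) (region S a)"
    unfolding B_def using S reg by (intro emeasure_lborel_on_translation) auto
  finally show ?thesis .
qed

theorem lattice_volume_flows:
  assumes S: "exits S" and a: "\<And>i. 0 \<le> a i"
  shows "lattice_volume S (flows S a) (flows S (\<lambda>_. 0)) (card (free S)) {x \<in> flows S a. \<forall>e\<in>S. 0 \<le> x e} =
    volume_sum S a"
proof -
  let ?Q = "\<lambda>(p, w). p \<in> flows S a \<and> integer_lattice_basis S (flows S (\<lambda>_. 0)) (card (free S)) w"
  obtain x where x: "\<And>i. i \<in> src ` S \<Longrightarrow> net S x i = a i"
    using flow_exists[OF S, of a "\<lambda>_. 0"] by metis
  then have "restrict x S \<in> flows S a"
    by (simp add: flows_def)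
  then have "\<exists>z. ?Q z"
    using integer_lattice_basis_exists[OF S] by auto
  then have "?Q (SOME z. ?Q z)"
    by (rule someI_ex)
  moreover obtain p w where pw: "(SOME z. ?Q z) = (p, w)"
    by fastforce
  ultimately have Q: "p \<in> flows S a" "integer_lattice_basis S (flows S (\<lambda>_. 0)) (card (free S)) w"
    by simp_all
  show ?thesis
    unfolding lattice_volume_def pw Let_def prod.case measure_def emeasure_chart[OF S Q] emeasure_region[of S a, OF S a]
    by (simp add: volume_sum_nonneg a)
qed

end

section \<open>Regrouping the volume formula\<close>

text \<open>Positive out-degrees make n + 1 the only sink: every other vertex has an exit arc, and
  the tails are exactly 1, ..., n.\<close>

locale flow_graph_exits = flow_graph G n for G :: "(nat, 'e) pre_digraph" and n :: nat +
  assumes out_degree_pos: "j \<in> {1..n} \<Longrightarrow> out_degree G j \<ge> 1"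
begin

definition exit_arc :: "nat \<Rightarrow> 'e" where
  "exit_arc i = (SOME e. e \<in> arcs G \<and> tail G e = i)"

sublocale exit_choice "tail G" "head G" exit_arc .

lemma exit_arc:
  assumes "i \<in> {1..n}"
  shows "exit_arc i \<in> arcs G" "tail G (exit_arc i) = i"
proof -
  have "out_arcs G i \<noteq> {}"
    using out_degree_pos[OF assms] by (auto simp: out_degree_def)
  then have "\<exists>e. e \<in> arcs G \<and> tail G e = i"
    by auto
  then have "exit_arc i \<in> arcs G \<and> tail G (exit_arc i) = i"
    unfolding exit_arc_def by (rule someI_ex)
  then show "exit_arc i \<in> arcs G" "tail G (exit_arc i) = i"
    by auto
qed

lemma head_le: "e \<in> arcs G \<Longrightarrow> head G e \<le> n + 1"
  using head_in_verts[of e] verts_eq by auto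

lemma tail_arcs: "tail G ` arcs G = {1..n}"
proof (intro equalityI subsetI)
  fix i assume "i \<in> tail G ` arcs G"
  then obtain e where e: "e \<in> arcs G" "i = tail G e" by auto
  then show "i \<in> {1..n}"
    using tail_in_verts[of e] verts_eq head_le[of e] forward[of e] by auto
next
  fix i assume "i \<in> {1..n}"
  then show "i \<in> tail G ` arcs G"
    using exit_arc[of i] by (metis imageI)
qed

lemma exits_arcs [simp]: "exits (arcs G)"
  unfolding exits_def tail_arcs using finite_arcs forward exit_arc by auto

text \<open>The tail recovers a vertex from its exit arc, so there are \<open>n\<close> exit arcs.
  The inequality lets the truncated difference be read as an integer difference.\<close>

lemma card_free: "card (free (arcs G)) = card (arcs G) - n" and n_le_card: "n \<le> card (arcs G)"
proof -
  have inj: "inj_on exit_arc {1..n}"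
    using exit_arc(2) by (metis inj_onI)
  have sub: "exit_arc ` {1..n} \<subseteq> arcs G"
    using exit_arc(1) by auto
  show "card (free (arcs G)) = card (arcs G) - n"
    unfolding free_def tail_arcs using card_image[OF inj] sub by (simp add: card_Diff_subset)
  show "n \<le> card (arcs G)"
    using card_image[OF inj] card_mono[OF finite_arcs sub] by simp
qed

lemma net_flow_eq: "net_flow G x j = net (arcs G) x j"
proof -
  have "net_flow G x j = (\<Sum>e\<in>arcs G. if tail G e = j then x e else 0) - (\<Sum>e\<in>arcs G. if head G e = j then x e else 0)"
    unfolding net_flow_def out_arcs_def in_arcs_def by (simp add: sum.inter_filter)
  also have "\<dots> = net (arcs G) x j"
    unfolding net_def sum_subtractf[symmetric] by (intro sum.cong) (auto simp: eq_commute)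
  finally show ?thesis .
qed

lemma flow_space_eq: "flow_space G n a = flows (arcs G) a"
  by (simp add: flow_space_def flows_def tail_arcs net_flow_eq del: ball_simps)

lemma flow_volume_eq:
  assumes "\<And>i. 0 \<le> a i"
  shows "flow_volume G n a = fact (card (arcs G) - n) * volume_sum (arcs G) a"
  unfolding flow_volume_def flow_polytope_def flow_space_eq card_free[symmetric]
  by (simp add: lattice_volume_flows assms)

lemma expo_arcs:
  assumes "j \<in> {1..n}"
  shows "expo (arcs G) b j = net (arcs G) (\<lambda>e. int (b e)) j + shifted_out_degree G j"
proof -
  have "(\<Sum>e\<in>arcs G. of_bool (j = tail G e)) = int (out_degree G j)"
    unfolding out_degree_def out_arcs_def by (simp add: of_bool_def sum.If_cases Int_def eq_commute)
  then show ?thesis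
    using assms by (simp add: expo_def tail_arcs shifted_out_degree_def)
qed

text \<open>This is homogeneity. Inner flows vanish on arcs into n + 1, so each unit leaves and
  enters vertices of \<open>{1..n}\<close> and the net flows cancel; the out-degrees count all arcs,
  and the shifts remove \<open>n\<close>.\<close>

lemma sum_expo:
  assumes b: "b \<in> inner_flows (arcs G)"
  shows "(\<Sum>i\<in>{1..n}. expo (arcs G) b i) = int (card (arcs G)) - int n"
proof -
  have "(\<Sum>i\<in>{1..n}. net (arcs G) (\<lambda>e. int (b e)) i) =
      (\<Sum>e\<in>arcs G. \<Sum>i\<in>{1..n}. int (b e) * (of_bool (i = tail G e) - of_bool (i = head G e)))"
    unfolding net_def by (rule sum.swap)
  also have "\<dots> = 0"
  proof (rule sum.neutral, rule ballI)
    fix e assume e: "e \<in> arcs G"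
    have "(\<Sum>i\<in>{1..n}. of_bool (i = tail G e)) = (1::int)"
      using e tail_arcs by (auto simp: of_bool_def)
    moreover have "(\<Sum>i\<in>{1..n}. of_bool (i = head G e)) = (1::int)" if "b e \<noteq> 0"
    proof -
      have "head G e \<in> {1..n}"
        using b that by (auto simp: inner_flows_def tail_arcs)
      then show ?thesis
        by (auto simp: of_bool_def)
    qed
    ultimately show "(\<Sum>i\<in>{1..n}. int (b e) * (of_bool (i = tail G e) - of_bool (i = head G e))) = 0"
      by (cases "b e = 0") (simp_all add: sum_distrib_left[symmetric] sum_subtractf)
  qed
  finally have 1: "(\<Sum>i\<in>{1..n}. net (arcs G) (\<lambda>e. int (b e)) i) = 0" .
  have "(\<Sum>i\<in>{1..n}. \<Sum>e\<in>arcs G. of_bool (i = tail G e)) = (\<Sum>e\<in>arcs G. \<Sum>i\<in>{1..n}. (of_bool (i = tail G e) :: int))"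
    by (rule sum.swap)
  also have "\<dots> = (\<Sum>e\<in>arcs G. 1)"
    using tail_arcs by (intro sum.cong refl) (auto simp: of_bool_def)
  finally have 2: "(\<Sum>i\<in>{1..n}. \<Sum>e\<in>arcs G. of_bool (i = tail G e)) = int (card (arcs G))"
    by simp
  have "(\<Sum>i\<in>{1..n}. expo (arcs G) b i) = (\<Sum>i\<in>{1..n}. net (arcs G) (\<lambda>e. int (b e)) i +
      (\<Sum>e\<in>arcs G. of_bool (i = tail G e)) - 1)"
    by (intro sum.cong refl) (simp add: expo_def tail_arcs)
  also have "\<dots> = int (card (arcs G)) - int n"
    unfolding sum_subtractf sum.distrib 1 2 by simp
  finally show ?thesis .
qed

text \<open>An integral flow on \<open>G\<close> that vanishes on the arcs into \<open>n + 1\<close> is one on \<open>G \<restriction> {1..n}\<close>.\<close>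

lemma kostant_partition_eq:
  assumes nn: "\<And>j. j \<in> {1..n} \<Longrightarrow> 0 \<le> J j"
  shows "kostant_partition (G \<restriction> {1..n}) (\<lambda>j. J j - shifted_out_degree G j) =
    card {b \<in> inner_flows (arcs G). \<forall>j\<in>{1..n}. expo (arcs G) b j = J j}"
proof -
  let ?H = "G \<restriction> {1..n}"
  let ?E = "arcs G"
  define A where "A = arcs ?H"
  have arcs: "A = {e \<in> ?E. head G e \<in> tail G ` ?E}"
    using tail_arcs by (auto simp: A_def)
  have sub: "A \<subseteq> ?E"
    unfolding arcs by auto
  define K where "K = {b \<in> A \<rightarrow>\<^sub>E (UNIV :: nat set). \<forall>j\<in>{1..n}.
      (\<Sum>e\<in>A. int (b e) * (of_bool (j = tail G e) - of_bool (j = head G e))) = J j - shifted_out_degree G j}"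
  define L where "L = {b \<in> inner_flows ?E. \<forall>j\<in>{1..n}. expo ?E b j = J j}"
  \<comment> \<open>Kostant tuples are \<open>undefined\<close> off \<open>A\<close>, whereas inner
    flows are 0 there; \<open>z\<close> translates between the two conventions.\<close>
  define z where "z b e = (if e \<in> A then b e else 0)" for b :: "'e \<Rightarrow> nat" and e
  have net: "net ?E (\<lambda>e. int (b e)) j =
      (\<Sum>e\<in>A. int (b e) * (of_bool (j = tail G e) - of_bool (j = head G e)))"
    if "\<forall>e. e \<notin> A \<longrightarrow> b e = 0" for b :: "'e \<Rightarrow> nat" and j
    unfolding net_def using that sub by (intro sum.mono_neutral_right) auto
  have inner0: "b e = 0" if "b \<in> inner_flows ?E" "e \<notin> A" for b e
    using that unfolding arcs inner_flows_def by blast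
  have "bij_betw (\<lambda>b. restrict b (A)) L K"
  proof (rule bij_betwI[where g = z])
    show "(\<lambda>b. restrict b (A)) \<in> L \<rightarrow> K"
    proof
      fix b assume b: "b \<in> L"
      then have 0: "\<forall>e. e \<notin> A \<longrightarrow> b e = 0"
        using inner0 by (auto simp: L_def)
      have "(\<Sum>e\<in>A. int (b e) * (of_bool (j = tail G e) - of_bool (j = head G e))) = J j - shifted_out_degree G j"
        if "j \<in> {1..n}" for j
      proof -
        have "expo ?E b j = J j"
          using b that unfolding L_def by blast
        then show ?thesis
          unfolding net[OF 0, symmetric] expo_arcs[OF that] by simp
      qed
      then show "restrict b (A) \<in> K"
        by (simp add: K_def)
    qed
    show "z \<in> K \<rightarrow> L"
    proof
      fix b assume b: "b \<in> K"
      have z0: "\<forall>e. e \<notin> A \<longrightarrow> z b e = 0"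
        unfolding z_def by simp
      have ex: "expo ?E (z b) j = J j" if j: "j \<in> {1..n}" for j
      proof -
        have "net ?E (\<lambda>e. int (z b e)) j = (\<Sum>e\<in>A. int (b e) * (of_bool (j = tail G e) - of_bool (j = head G e)))"
          unfolding net[OF z0] by (intro sum.cong refl) (simp add: z_def)
        also have "\<dots> = J j - shifted_out_degree G j"
          using b j unfolding K_def by blast
        finally show ?thesis
          by (simp add: expo_arcs[OF j])
      qed
      have "0 \<le> expo ?E (z b) j" for j
        using ex[of j] nn[of j] by (cases "j \<in> {1..n}") (auto simp: expo_def tail_arcs)
      moreover have "\<forall>e. e \<notin> ?E \<or> head G e \<notin> tail G ` ?E \<longrightarrow> z b e = 0"
        using z0 arcs by blast
      ultimately show "z b \<in> L"
        using ex unfolding L_def inner_flows_def by blast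
    qed
    fix b assume "b \<in> L"
    then have "b e = 0" if "e \<notin> A" for e
      using inner0 that by (auto simp: L_def)
    then show "z (restrict b (A)) = b"
      unfolding z_def by auto
  next
    fix b assume "b \<in> K"
    then have "b \<in> extensional (A)"
      unfolding K_def PiE_def by blast
    then show "restrict (z b) (A) = b"
      unfolding z_def by (auto simp: extensional_def restrict_def)
  qed
  then have "card L = card K"
    by (rule bij_betw_same_card)
  then show ?thesis
    by (simp add: kostant_partition_def K_def L_def A_def)
qed

end

section \<open>Evaluation at a vector supported on the vertices 1 and k\<close>

theorem proposition6p3:
  fixes G :: "(nat, 'e) pre_digraph" and n m k a b :: nat and t :: "nat \<Rightarrow> int"
  assumes "flow_graph G n"
    and "Digraph_Component.connected G"
    and "\<forall>j\<in>{1..n}. out_degree G j \<ge> 1"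
  defines "m \<equiv> card (arcs G)"
    and "t \<equiv> shifted_out_degree G"
  assumes "a > 0" and "b > 0" and "2 \<le> k" and "k \<le> n"
  shows "flow_volume G n (\<lambda>j. real a * of_bool (j = 1) + real b * of_bool (j = k)) =
    (\<Sum>i | int i \<le> int m - int n - t 1.
       real ((m - n) choose i) * real a ^ (m - n - i) * real b ^ i *
       real (kostant_partition (G \<restriction> {1..n})
         (\<lambda>j. if j = 1 then int m - int n - int i - t 1
              else if j = k then int i - t k
              else - t j)))"
proof -
  interpret flow_graph G n by fact
  interpret flow_graph_exits G n
    by standard (use assms(3) in blast)
  define N where "N = m - n"
  have N: "int N = int m - int n"
    using n_le_card by (simp add: N_def m_def)
  have k: "1 \<in> {1..n}" "k \<in> {1..n}" "k \<noteq> 1"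
    using assms by auto
  have t1: "0 \<le> t 1"
    using out_degree_pos[OF k(1)] by (simp add: t_def shifted_out_degree_def)
  \<comment> \<open>The bound is an inequality of integers; as \<open>t 1\<close> is nonnegative it
    gives \<open>i \<le> N\<close>, so the natural number \<open>N - i\<close> is the true
    difference.\<close>
  define I where "I = {i. int i \<le> int m - int n - t 1}"
  have IN: "i \<le> N" if "i \<in> I" for i
    using that t1 N by (simp add: I_def)
  have finI: "finite I"
    using IN by (intro finite_subset[of I "{..N}"]) auto
  define A where "A j = real a * of_bool (j = 1) + real b * of_bool (j = k)" for j
  define x where "x = expo (arcs G)"
  define F where "F = inner_flows (arcs G)"
  have finF: "finite F"
    by (simp add: F_def)
  \<comment> \<open>\<open>A\<close> vanishes off 1 and \<open>k\<close>, and a divided power of 0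
    is nonzero only for exponent 0; so these are the flows that contribute.\<close>
  define L where "L = {c \<in> F. \<forall>j\<in>{1..n} - {1, k}. x c j = 0}"
  have nn: "0 \<le> x c j" if "c \<in> F" for c j
    using that by (simp add: F_def x_def inner_flows_def)
  have split: "(\<Sum>j\<in>{1..n}. g j) = g 1 + g k + (\<Sum>j\<in>{1..n} - {1, k}. g j)" for g :: "nat \<Rightarrow> int"
    using sum.subset_diff[of "{1, k}" "{1..n}" g] k by simp
  have x1: "x c 1 = int N - x c k" if "c \<in> L" for c
    using sum_expo[of c] split[of "x c"] that by (simp add: L_def F_def x_def N m_def)
  \<comment> \<open>Vertex 1 is never a head, so its net flow is nonnegative. This is the origin of
    the upper limit m - n - t_1.\<close>
  have t1x: "t 1 \<le> x c 1" for c
  proof -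
    have "head G e \<noteq> 1" if "e \<in> arcs G" for e
      using forward[OF that] tail_arcs that by fastforce
    then have "0 \<le> net (arcs G) (\<lambda>e. int (c e)) 1"
      by (intro net_nonneg) auto
    then show ?thesis
      unfolding x_def t_def expo_arcs[OF k(1)] by simp
  qed
  have prod: "(\<Prod>j\<in>{1..n}. dpow (A j) (nat (x c j))) =
      dpow a (nat (x c 1)) * dpow b (nat (x c k)) * of_bool (c \<in> L)" if c: "c \<in> F" for c
  proof -
    have "(\<Prod>j\<in>{1..n}. dpow (A j) (nat (x c j))) =
        (\<Prod>j\<in>{1..n} - {1, k}. dpow (A j) (nat (x c j))) * (\<Prod>j\<in>{1, k}. dpow (A j) (nat (x c j)))"
      using k by (intro prod.subset_diff) auto
    also have "(\<Prod>j\<in>{1, k}. dpow (A j) (nat (x c j))) = dpow a (nat (x c 1)) * dpow b (nat (x c k))"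
      using k by (simp add: A_def)
    also have "(\<Prod>j\<in>{1..n} - {1, k}. dpow (A j) (nat (x c j))) =
        (\<Prod>j\<in>{1..n} - {1, k}. of_bool (x c j = 0))"
      using nn[OF c] by (intro prod.cong refl) (auto simp: A_def dpow_zero intro: antisym)
    also have "\<dots> = of_bool (c \<in> L)"
      using c by (auto simp: L_def)
    finally show ?thesis
      by simp
  qed
  have "volume_sum (arcs G) A = (\<Sum>c\<in>F. dpow a (nat (x c 1)) * dpow b (nat (x c k)) * of_bool (c \<in> L))"
    unfolding volume_sum_def tail_arcs F_def[symmetric] x_def[symmetric]
    by (intro sum.cong refl prod)
  also have "\<dots> = (\<Sum>c\<in>L. dpow a (nat (x c 1)) * dpow b (nat (x c k)))"
    using finF by (intro sum.mono_neutral_cong_right) (auto simp: L_def)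
  also have "\<dots> = (\<Sum>i\<in>I. \<Sum>c\<in>{c \<in> L. nat (x c k) = i}. dpow a (nat (x c 1)) * dpow b (nat (x c k)))"
  proof (rule sum.group[symmetric])
    show "finite L"
      using finF by (simp add: L_def)
    show "(\<lambda>c. nat (x c k)) ` L \<subseteq> I"
    proof safe
      fix c assume c: "c \<in> L"
      then have "0 \<le> x c k"
        by (intro nn) (simp add: L_def)
      then show "nat (x c k) \<in> I"
        using x1[OF c] t1x[of c] N by (simp add: I_def)
    qed
  qed (rule finI)
  also have "\<dots> = (\<Sum>i\<in>I. dpow a (N - i) * dpow b i *
      real (kostant_partition (G \<restriction> {1..n})
         (\<lambda>j. if j = 1 then int m - int n - int i - t 1
              else if j = k then int i - t k
              else - t j)))"
  proof (intro sum.cong refl)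
    fix i assume i: "i \<in> I"
    \<comment> \<open>On \<open>L\<close>, homogeneity forces the exponent \<open>N - i\<close> at
      1, so fixing the exponent at \<open>k\<close> fixes all of them.\<close>
    define J where "J j = (if j = 1 then int N - int i else if j = k then int i else 0)" for j
    have J: "(\<lambda>j. if j = 1 then int m - int n - int i - t 1 else if j = k then int i - t k else - t j) =
        (\<lambda>j. J j - shifted_out_degree G j)"
      unfolding J_def t_def N by auto
    have "{c \<in> L. nat (x c k) = i} = {c \<in> F. \<forall>j\<in>{1..n}. x c j = J j}"
    proof (intro set_eqI iffI)
      fix c assume "c \<in> {c \<in> L. nat (x c k) = i}"
      then have c: "c \<in> L" "nat (x c k) = i" by auto
      have "0 \<le> x c k"
        using c by (intro nn) (simp add: L_def)
      then have xk: "x c k = int i"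
        using c(2) by simp
      have "x c j = J j" if "j \<in> {1..n}" for j
        using c(1) xk x1[OF c(1)] that by (auto simp: J_def L_def)
      then show "c \<in> {c \<in> F. \<forall>j\<in>{1..n}. x c j = J j}"
        using c(1) by (simp add: L_def)
    next
      fix c assume c: "c \<in> {c \<in> F. \<forall>j\<in>{1..n}. x c j = J j}"
      then have "x c k = int i"
        using k by (simp add: J_def)
      with c show "c \<in> {c \<in> L. nat (x c k) = i}"
        by (auto simp: L_def J_def)
    qed
    moreover have "kostant_partition (G \<restriction> {1..n}) (\<lambda>j. J j - shifted_out_degree G j) =
        card {c \<in> F. \<forall>j\<in>{1..n}. x c j = J j}"
      unfolding F_def x_def using IN[OF i] by (intro kostant_partition_eq) (simp add: J_def)
    moreover have "(\<Sum>c\<in>{c \<in> L. nat (x c k) = i}. dpow a (nat (x c 1)) * dpow b (nat (x c k))) =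
        (\<Sum>c\<in>{c \<in> L. nat (x c k) = i}. dpow a (N - i) * dpow b i)"
    proof (intro sum.cong refl)
      fix c assume "c \<in> {c \<in> L. nat (x c k) = i}"
      then have c: "c \<in> L" "nat (x c k) = i" by auto
      have "0 \<le> x c k"
        using c by (intro nn) (simp add: L_def)
      then have "nat (x c 1) = N - i"
        using c x1[OF c(1)] by (simp add: nat_diff_distrib)
      then show "dpow a (nat (x c 1)) * dpow b (nat (x c k)) = dpow a (N - i) * dpow b i"
        using c by simp
    qed
    ultimately show "(\<Sum>c\<in>{c \<in> L. nat (x c k) = i}. dpow a (nat (x c 1)) * dpow b (nat (x c k))) =
      dpow a (N - i) * dpow b i * real (kostant_partition (G \<restriction> {1..n})
         (\<lambda>j. if j = 1 then int m - int n - int i - t 1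
              else if j = k then int i - t k
              else - t j))"
      unfolding J by simp
  qed
  finally have vol: "volume_sum (arcs G) A = (\<Sum>i\<in>I. dpow a (N - i) * dpow b i *
      real (kostant_partition (G \<restriction> {1..n})
         (\<lambda>j. if j = 1 then int m - int n - int i - t 1
              else if j = k then int i - t k
              else - t j)))" .
  have "flow_volume G n A = fact N * volume_sum (arcs G) A"
    unfolding N_def m_def by (rule flow_volume_eq) (simp add: A_def)
  also have "\<dots> = (\<Sum>i\<in>I. real (N choose i) * real a ^ (N - i) * real b ^ i *
      real (kostant_partition (G \<restriction> {1..n})
         (\<lambda>j. if j = 1 then int m - int n - int i - t 1
              else if j = k then int i - t k
              else - t j)))"
    unfolding vol sum_distrib_left
  proof (intro sum.cong refl)
    fix i assume "i \<in> I"
    then show "fact N * (dpow a (N - i) * dpow b i * r) =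
        real (N choose i) * real a ^ (N - i) * real b ^ i * r" for r
      using IN[of i] by (simp add: dpow_def binomial_fact mult_ac)
  qed
  finally show ?thesis
    unfolding A_def I_def N_def .
qed

end
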